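(* Let $S$ be a finite semigroup. Let $\mathbf{V}_S$ be the smallest variety of finite semigroups that is closed under two-sided semidirect products, contains the variety $\mathbf{SL}$ of finite semilattices, and contains all simple groups that divide $S$. Then $S \in \mathbf{V}_S$.
   Context: A semigroup $S$ divides a semigroup $T$ if $S$ is a homomorphic image of a subsemigroup of $T$. A variety of finite semigroups (often called a pseudovariety) is a class of finite semigroups closed under finite direct products, subsemigroups and homomorphic images. $\mathbf{SL}$ is the variety of finite semilattices, i.e. finite commutative semigroups in which every element is idempotent. Two-sided semidirect product: let $(V,+)$ be a (not necessarily commutative) semigroup, and let a semigroup $W$ act on $V$ on the left and on the right by semigroup endomorphisms, with the two actions commuting, i.e. $(wv)w' = w(vw')$ (the actions are not required to be unital, even if $W$ is a monoid). The two-sided semidirect product $V \bowtie W$ is the set $V \times W$ with multiplication $(v,w)(v',w') := (vw' + wv', ww')$. A variety is closed under two-sided semidirect products if it contains every $V \bowtie W$ (for all such actions) whenever it contains $V$ and $W$. *)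

theory Defs
  imports "HOL-Algebra.Algebra"
begin

text \<open>
  Semigroups are carried by the monoid records of HOL-Algebra, so that hom, epi, iso,
  product_group and simple_group can be reused. Only the fields carrier and mult matter here;
  the field one is arbitrary junk, except in groups. Semigroups are nonempty.
\<close>

definition fin_semigroup :: "('a, 'b) monoid_scheme \<Rightarrow> bool" where
  "fin_semigroup S \<longleftrightarrow>
     finite (carrier S) \<and> carrier S \<noteq> {} \<and>
     (\<forall>x\<in>carrier S. \<forall>y\<in>carrier S. x \<otimes>\<^bsub>S\<^esub> y \<in> carrier S) \<and>
     (\<forall>x\<in>carrier S. \<forall>y\<in>carrier S. \<forall>z\<in>carrier S.
        (x \<otimes>\<^bsub>S\<^esub> y) \<otimes>\<^bsub>S\<^esub> z = x \<otimes>\<^bsub>S\<^esub> (y \<otimes>\<^bsub>S\<^esub> z))"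

definition fin_semilattice :: "('a, 'b) monoid_scheme \<Rightarrow> bool" where
  "fin_semilattice S \<longleftrightarrow>
     fin_semigroup S \<and>
     (\<forall>x\<in>carrier S. \<forall>y\<in>carrier S. x \<otimes>\<^bsub>S\<^esub> y = y \<otimes>\<^bsub>S\<^esub> x) \<and>
     (\<forall>x\<in>carrier S. x \<otimes>\<^bsub>S\<^esub> x = x)"

definition subsemigroup :: "'a set \<Rightarrow> ('a, 'b) monoid_scheme \<Rightarrow> bool" where
  "subsemigroup H S \<longleftrightarrow>
     H \<subseteq> carrier S \<and> H \<noteq> {} \<and> (\<forall>x\<in>H. \<forall>y\<in>H. x \<otimes>\<^bsub>S\<^esub> y \<in> H)"

definition sgrp_divides :: "('a, 'b) monoid_scheme \<Rightarrow> ('c, 'd) monoid_scheme \<Rightarrow> bool" where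
  "sgrp_divides S T \<longleftrightarrow> (\<exists>H. subsemigroup H T \<and> epi (T\<lparr>carrier := H\<rparr>) S \<noteq> {})"

text \<open>
  In \<open>commuting_actions V W l r\<close>, \<open>l w v\<close> stands for \<open>wv\<close> and \<open>r v w\<close> for \<open>vw\<close>.
  The operation of V, written additively on paper, is the multiplication of the record V.
\<close>

definition commuting_actions ::
  "('v, 'b) monoid_scheme \<Rightarrow> ('w, 'c) monoid_scheme \<Rightarrow> ('w \<Rightarrow> 'v \<Rightarrow> 'v) \<Rightarrow> ('v \<Rightarrow> 'w \<Rightarrow> 'v) \<Rightarrow> bool"
where
  "commuting_actions V W l r \<longleftrightarrow>
     (\<forall>w\<in>carrier W. (\<lambda>v. l w v) \<in> hom V V) \<and>
     (\<forall>w\<in>carrier W. (\<lambda>v. r v w) \<in> hom V V) \<and>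
     (\<forall>w\<in>carrier W. \<forall>w'\<in>carrier W. \<forall>v\<in>carrier V. l (w \<otimes>\<^bsub>W\<^esub> w') v = l w (l w' v)) \<and>
     (\<forall>w\<in>carrier W. \<forall>w'\<in>carrier W. \<forall>v\<in>carrier V. r v (w \<otimes>\<^bsub>W\<^esub> w') = r (r v w) w') \<and>
     (\<forall>w\<in>carrier W. \<forall>w'\<in>carrier W. \<forall>v\<in>carrier V. r (l w v) w' = l w (r v w'))"

definition two_sided_semidirect ::
  "('v, 'b) monoid_scheme \<Rightarrow> ('w, 'c) monoid_scheme \<Rightarrow> ('w \<Rightarrow> 'v \<Rightarrow> 'v) \<Rightarrow> ('v \<Rightarrow> 'w \<Rightarrow> 'v) \<Rightarrow>
   ('v \<times> 'w) monoid"
where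
  "two_sided_semidirect V W l r =
     \<lparr>carrier = carrier V \<times> carrier W,
      monoid.mult = (\<lambda>(v, w) (v', w'). (r v w' \<otimes>\<^bsub>V\<^esub> l w v', w \<otimes>\<^bsub>W\<^esub> w')),
      one = (\<one>\<^bsub>V\<^esub>, \<one>\<^bsub>W\<^esub>)\<rparr>"

text \<open>
  Every finite semigroup is isomorphic to one whose elements are natural numbers. A class of
  finite semigroups (closed under isomorphism) is therefore represented by the set of its
  members over nat, and a semigroup over any other type belongs to the class if it is
  isomorphic to one of these.
\<close>

definition in_class :: "('a, 'b) monoid_scheme \<Rightarrow> nat monoid set \<Rightarrow> bool" where
  "in_class S C \<longleftrightarrow> (\<exists>T\<in>C. T \<cong> S)"

text \<open>The empty direct product (the trivial semigroup) is the case \<open>n = 0\<close>.\<close>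

definition variety :: "nat monoid set \<Rightarrow> bool" where
  "variety C \<longleftrightarrow>
     (\<forall>T\<in>C. fin_semigroup T) \<and>
     (\<forall>(n::nat) F. (\<forall>i<n. F i \<in> C) \<longrightarrow> in_class (product_group {..<n} F) C) \<and>
     (\<forall>T\<in>C. \<forall>H. subsemigroup H T \<longrightarrow> in_class (T\<lparr>carrier := H\<rparr>) C) \<and>
     (\<forall>T\<in>C. \<forall>U :: nat monoid. epi T U \<noteq> {} \<longrightarrow> U \<in> C)"

definition closed_under_two_sided_semidirect :: "nat monoid set \<Rightarrow> bool" where
  "closed_under_two_sided_semidirect C \<longleftrightarrow>
     (\<forall>V\<in>C. \<forall>W\<in>C. \<forall>l r. commuting_actions V W l r \<longrightarrow>
        in_class (two_sided_semidirect V W l r) C)"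

definition admissible :: "('a, 'b) monoid_scheme \<Rightarrow> nat monoid set \<Rightarrow> bool" where
  "admissible S C \<longleftrightarrow>
     variety C \<and>
     closed_under_two_sided_semidirect C \<and>
     (\<forall>L :: nat monoid. fin_semilattice L \<longrightarrow> L \<in> C) \<and>
     (\<forall>G :: nat monoid. simple_group G \<and> sgrp_divides G S \<longrightarrow> G \<in> C)"

definition V_class :: "('a, 'b) monoid_scheme \<Rightarrow> nat monoid set" where
  "V_class S = \<Inter> {C. admissible S C}"


lemma in_class_iso_closed:
  fixes T :: "nat monoid"
  assumes "variety C"
  shows "in_class T C \<longleftrightarrow> T \<in> C"
proof
  assume "in_class T C"
  then obtain U h where "U \<in> C" "h \<in> iso U T"
    unfolding in_class_def is_iso_def by blast
  then have "h \<in> epi U T"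
    by (auto simp: iso_def epi_def bij_betw_def)
  with \<open>U \<in> C\<close> assms show "T \<in> C"
    unfolding variety_def by blast
next
  assume "T \<in> C"
  then show "in_class T C"
    unfolding in_class_def by (meson iso_refl)
qed

lemma in_class_nat_copy:
  fixes U :: "nat monoid"
  assumes "variety C" "h \<in> iso U S" "fin_semigroup U"
  shows "in_class S C \<longleftrightarrow> U \<in> C"
proof
  assume "in_class S C"
  then obtain T g where T: "T \<in> C" "g \<in> iso T S"
    unfolding in_class_def is_iso_def by blast
  have "inv_into (carrier U) h \<in> iso S U"
  proof -
    have b: "bij_betw (inv_into (carrier U) h) (carrier S) (carrier U)"
      using assms(2) by (simp add: iso_def bij_betw_inv_into)
    have "inv_into (carrier U) h (x \<otimes>\<^bsub>S\<^esub> y)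
        = inv_into (carrier U) h x \<otimes>\<^bsub>U\<^esub> inv_into (carrier U) h y"
      if "x \<in> carrier S" "y \<in> carrier S" for x y
    proof -
      have hb: "bij_betw h (carrier U) (carrier S)" and hh: "h \<in> hom U S"
        using assms(2) by (auto simp: iso_def)
      have inv: "inv_into (carrier U) h (h a) = a" if "a \<in> carrier U" for a
        using hb that by (rule bij_betw_inv_into_left)
      have "x \<in> h ` carrier U" "y \<in> h ` carrier U"
        using that bij_betw_imp_surj_on[OF hb] by simp_all
      then obtain a b where ab: "a \<in> carrier U" "b \<in> carrier U" "x = h a" "y = h b"
        by blast
      have "a \<otimes>\<^bsub>U\<^esub> b \<in> carrier U"
        using ab assms(3) by (simp add: fin_semigroup_def)
      moreover have "h (a \<otimes>\<^bsub>U\<^esub> b) = h a \<otimes>\<^bsub>S\<^esub> h b"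
        using hh ab by (simp add: hom_def)
      ultimately show ?thesis
        using ab inv by metis
    qed
    with b show ?thesis
      by (auto simp: iso_def hom_def bij_betw_def)
  qed
  then have "inv_into (carrier U) h \<circ> g \<in> iso T U"
    using T(2) iso_set_trans by blast
  then have "in_class U C"
    using T(1) unfolding in_class_def is_iso_def by blast
  then show "U \<in> C"
    using assms(1) in_class_iso_closed by blast
next
  assume "U \<in> C"
  with assms(2) show "in_class S C"
    unfolding in_class_def is_iso_def by blast
qed

lemma fin_semigroup_nat_copy:
  assumes "fin_semigroup S"
  obtains U :: "nat monoid" and h where "h \<in> iso U S" "fin_semigroup U"
proof -
  have fin: "finite (carrier S)"
    using assms by (simp add: fin_semigroup_def)
  obtain f :: "nat \<Rightarrow> 'a" where f: "bij_betw f {0..<card (carrier S)} (carrier S)"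
    using ex_bij_betw_nat_finite[OF fin] by blast
  define A where "A = {0..<card (carrier S)}"
  define g where "g = inv_into A f"
  define U :: "nat monoid" where
    "U = \<lparr>carrier = A, monoid.mult = (\<lambda>i j. g (f i \<otimes>\<^bsub>S\<^esub> f j)), one = 0\<rparr>"
  have fA: "f i \<in> carrier S" if "i \<in> A" for i
    using f that by (auto simp: A_def bij_betw_def)
  have gA: "g x \<in> A" "f (g x) = x" if "x \<in> carrier S" for x
    using f that
    by (auto simp: A_def g_def bij_betw_def inv_into_into f_inv_into_f simp del: atLeastLessThan_iff)
  have cl: "x \<otimes>\<^bsub>S\<^esub> y \<in> carrier S" if "x \<in> carrier S" "y \<in> carrier S" for x y
    using assms that by (simp add: fin_semigroup_def)
  have ass: "(x \<otimes>\<^bsub>S\<^esub> y) \<otimes>\<^bsub>S\<^esub> z = x \<otimes>\<^bsub>S\<^esub> (y \<otimes>\<^bsub>S\<^esub> z)"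
    if "x \<in> carrier S" "y \<in> carrier S" "z \<in> carrier S" for x y z
    using assms that by (simp add: fin_semigroup_def)
  have ne: "A \<noteq> {}"
    using assms gA(1) by (force simp: fin_semigroup_def)
  have "fin_semigroup U"
    using fA gA cl ass ne by (simp add: fin_semigroup_def U_def) (simp add: A_def)
  moreover have "f \<in> iso U S"
    using f fA gA cl by (auto simp: iso_def hom_def U_def simp flip: A_def)
  ultimately show thesis
    using that by blast
qed

lemma fin_semigroup_product:
  assumes "\<And>i. i < (n::nat) \<Longrightarrow> fin_semigroup (F i)"
  shows "fin_semigroup (product_group {..<n} F)"
  unfolding fin_semigroup_def
proof (intro conjI ballI)
  show "finite (carrier (product_group {..<n} F))"
    using assms by (auto simp: fin_semigroup_def intro!: finite_PiE)
  show "carrier (product_group {..<n} F) \<noteq> {}"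
    using assms by (auto simp: fin_semigroup_def PiE_eq_empty_iff)
qed (use assms in \<open>auto simp: fin_semigroup_def product_group_def PiE_iff intro!: ext\<close>)

lemma fin_semigroup_two_sided_semidirect:
  assumes V: "fin_semigroup V" and W: "fin_semigroup W" and a: "commuting_actions V W l r"
  shows "fin_semigroup (two_sided_semidirect V W l r)"
proof -
  have lc: "l w v \<in> carrier V" and rc: "r v w \<in> carrier V"
    if "v \<in> carrier V" "w \<in> carrier W" for v w
    using a that by (auto simp: commuting_actions_def hom_def)
  have lh: "l w (v \<otimes>\<^bsub>V\<^esub> v') = l w v \<otimes>\<^bsub>V\<^esub> l w v'"
    and rh: "r (v \<otimes>\<^bsub>V\<^esub> v') w = r v w \<otimes>\<^bsub>V\<^esub> r v' w"
    if "v \<in> carrier V" "v' \<in> carrier V" "w \<in> carrier W" for v v' w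
    using a that by (auto simp: commuting_actions_def hom_def)
  have act: "l (w \<otimes>\<^bsub>W\<^esub> w') v = l w (l w' v)" "r v (w \<otimes>\<^bsub>W\<^esub> w') = r (r v w) w'"
    "r (l w v) w' = l w (r v w')"
    if "v \<in> carrier V" "w \<in> carrier W" "w' \<in> carrier W" for v w w'
    using a that by (auto simp: commuting_actions_def)
  show ?thesis
    using V W by (auto simp: fin_semigroup_def two_sided_semidirect_def lc rc lh rh act)
qed

lemma fin_semigroup_epi_image:
  assumes T: "fin_semigroup T" and h: "h \<in> epi T U"
  shows "fin_semigroup U"
proof -
  have hm: "h (x \<otimes>\<^bsub>T\<^esub> y) = h x \<otimes>\<^bsub>U\<^esub> h y"
    if "x \<in> carrier T" "y \<in> carrier T" for x y
    using h that by (auto simp: epi_def hom_def)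
  have im: "carrier U = h ` carrier T"
    using h by (auto simp: epi_def)
  have cl: "x \<otimes>\<^bsub>T\<^esub> y \<in> carrier T" if "x \<in> carrier T" "y \<in> carrier T" for x y
    using T that by (simp add: fin_semigroup_def)
  show ?thesis
    unfolding fin_semigroup_def im
    using T by (auto simp: fin_semigroup_def simp flip: hm)
qed

lemma in_class_all:
  assumes "fin_semigroup Y"
  shows "in_class Y {T. fin_semigroup T}"
  using fin_semigroup_nat_copy[OF assms] unfolding in_class_def is_iso_def by blast

text \<open>The class of all finite semigroups is admissible, so \<open>V_class\<close> is not a vacuous intersection.\<close>

lemma admissible_all:
  fixes S :: "('a, 'b) monoid_scheme"
  shows "admissible S {T. fin_semigroup T}"
proof -
  have sub: "fin_semigroup (T\<lparr>carrier := H\<rparr>)" if "fin_semigroup T" "subsemigroup H T"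
    for T :: "nat monoid" and H
    using that by (auto simp: fin_semigroup_def subsemigroup_def subset_iff intro: finite_subset)
  have grp: "fin_semigroup G" if "simple_group G" for G :: "nat monoid"
  proof -
    interpret simple_group G by fact
    have "finite (carrier G)"
      using order_gt_one by (auto simp: order_def intro: card_ge_0_finite)
    then show ?thesis
      by (auto simp: fin_semigroup_def m_assoc)
  qed
  have "variety {T. fin_semigroup T}"
    unfolding variety_def
    by (simp add: in_class_all fin_semigroup_product sub)
      (meson all_not_in_conv fin_semigroup_epi_image)
  moreover have "closed_under_two_sided_semidirect {T. fin_semigroup T}"
    unfolding closed_under_two_sided_semidirect_def
    by (simp add: in_class_all fin_semigroup_two_sided_semidirect)
  ultimately show ?thesis
    unfolding admissible_def using grp by (auto simp: fin_semilattice_def)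
qed

lemma in_class_V_class:
  assumes "\<And>C. admissible S C \<Longrightarrow> in_class Y C"
  shows "in_class Y (V_class S)"
proof -
  obtain T :: "nat monoid" and g where T: "fin_semigroup T" "g \<in> iso T Y"
    using assms[OF admissible_all] unfolding in_class_def is_iso_def by blast
  have "T \<in> C" if "admissible S C" for C
    using in_class_nat_copy[OF _ T(2,1)] assms[OF that] that by (auto simp: admissible_def)
  then have "T \<in> V_class S"
    by (auto simp: V_class_def)
  with T(2) show ?thesis
    unfolding in_class_def is_iso_def by blast
qed

text \<open>\<open>V_class S\<close> is itself admissible, hence the least admissible class.\<close>

lemma admissible_V_class: "admissible S (V_class S)"
proof -
  have mem: "T \<in> C" if "T \<in> V_class S" "admissible S C" for T C
    using that by (auto simp: V_class_def)
  have "variety (V_class S)"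
    unfolding variety_def
  proof (intro conjI ballI allI impI)
    show "fin_semigroup T" if "T \<in> V_class S" for T
      using mem[OF that admissible_all] by simp
    show "in_class (product_group {..<n} F) (V_class S)" if "\<forall>i<n. F i \<in> V_class S" for n :: nat and F
    proof (rule in_class_V_class)
      fix C assume C: "admissible S C"
      then have "\<forall>i<n. F i \<in> C"
        using that mem by blast
      with C show "in_class (product_group {..<n} F) C"
        by (simp add: admissible_def variety_def)
    qed
    show "in_class (T\<lparr>carrier := H\<rparr>) (V_class S)" if "T \<in> V_class S" "subsemigroup H T" for T H
    proof (rule in_class_V_class)
      fix C assume C: "admissible S C"
      with C mem that show "in_class (T\<lparr>carrier := H\<rparr>) C"
        unfolding admissible_def variety_def by blast
    qed
    show "U \<in> V_class S" if "T \<in> V_class S" "epi T U \<noteq> {}" for T U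
    proof -
      have "U \<in> C" if C: "admissible S C" for C
      proof -
        have "T \<in> C"
          using mem \<open>T \<in> V_class S\<close> C by blast
        with C \<open>epi T U \<noteq> {}\<close> show ?thesis
          unfolding admissible_def variety_def by blast
      qed
      then show ?thesis
        by (simp add: V_class_def)
    qed
  qed
  moreover have "closed_under_two_sided_semidirect (V_class S)"
    unfolding closed_under_two_sided_semidirect_def
  proof (intro ballI allI impI in_class_V_class)
    fix V W l r C
    assume "V \<in> V_class S" "W \<in> V_class S" "commuting_actions V W l r" "admissible S C"
    with mem show "in_class (two_sided_semidirect V W l r) C"
      unfolding admissible_def closed_under_two_sided_semidirect_def by blast
  qed
  ultimately show ?thesis
    unfolding admissible_def by (auto simp: V_class_def admissible_def)
qed

lemma V_class_least: "admissible S C \<Longrightarrow> V_class S \<subseteq> C"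
  by (auto simp: V_class_def)

end

theory Submission
  imports Defs
begin

text \<open>
  Let \<open>C\<close> be a variety of finite semigroups that is closed under two-sided semidirect products and
  contains the finite semilattices. By induction on its order, every finite monoid \<open>M\<close> whose simple
  group divisors lie in \<open>C\<close> belongs to \<open>C\<close>. A semigroup reduces to this case because adjoining an
  identity creates no new simple group divisors.

  If \<open>M\<close> is a group that is neither trivial nor simple, it embeds into the wreath product of a proper
  nontrivial normal subgroup by the quotient (Krasner and Kaloujnine, lemma \<open>in_class_extension\<close>), and
  both factors are smaller divisors of \<open>M\<close>.

  If \<open>M\<close> is not a group, the argument uses the local divisors of Diekert, Kufleitner and Steinberg.
  Choose a maximal proper submonoid \<open>N\<close> above the units and some \<open>c\<close> outside \<open>N\<close>. Then \<open>M\<close> is generated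
  by \<open>N\<close> and \<open>c\<close>, so that every element lies in \<open>N\<close> or is a product
  \<open>n\<^sub>0 c n\<^sub>1 c \<dots> c n\<^sub>k\<close> with \<open>k \<ge> 1\<close> and all \<open>n\<^sub>i\<close> in \<open>N\<close>. The set \<open>L = cM \<inter> Mc\<close> is a monoid with
  identity \<open>c\<close> under \<open>uc \<circ> cv = ucv\<close>. It divides \<open>M\<close>, and it is smaller than \<open>M\<close> because \<open>c\<close> is not a
  unit. In it, the inner part of the product is
  \<open>c n\<^sub>1 c \<dots> n\<^bsub>k-1\<^esub> c = (c n\<^sub>1 c) \<circ> \<dots> \<circ> (c n\<^bsub>k-1\<^esub> c)\<close>. The element is therefore known once the outer
  blocks \<open>n\<^sub>0\<close> and \<open>n\<^sub>k\<close> and this value in \<open>L\<close> are known.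

  The outer blocks are recorded by a two-sided semidirect product \<open>W\<close> of \<open>N \<times> N\<close> by the two-element
  semilattice, whose element \<open>False\<close> says that a \<open>c\<close> has occurred: acting on the left it erases the
  first coordinate, acting on the right it erases the second, so the first coordinate stops growing
  after the first \<open>c\<close> and the second one restarts at each \<open>c\<close>. Having actions on both sides is what
  makes a semilattice sufficient here. The value in \<open>L\<close> is accumulated by a wreath product of \<open>L\<close> by
  \<open>W\<close>: as \<open>W\<close> keeps the last block \<open>n\<close> before each \<open>c\<close>, it can supply the factor \<open>c n c\<close>.
  This is lemma \<open>in_class_local_divisor_extension\<close>.
\<close>

section \<open>Division of semigroups\<close>

text \<open>
  Division seen as a relational morphism: \<open>R y m\<close> reads "\<open>y\<close> represents \<open>m\<close>". The represented elements
  need not be given by a function beforehand, and the subsemigroup of \<open>Y\<close> is the domain of \<open>R\<close>.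
\<close>
lemma sgrp_divides_by_relation:
  assumes "carrier M \<noteq> {}"
    and "\<And>y m. R y m \<Longrightarrow> y \<in> carrier Y \<and> m \<in> carrier M"
    and onto: "\<And>m. m \<in> carrier M \<Longrightarrow> \<exists>y. R y m"
    and mult: "\<And>y m y' m'. R y m \<Longrightarrow> R y' m' \<Longrightarrow> R (y \<otimes>\<^bsub>Y\<^esub> y') (m \<otimes>\<^bsub>M\<^esub> m')"
    and uniq: "\<And>y m m'. R y m \<Longrightarrow> R y m' \<Longrightarrow> m = m'"
  shows "sgrp_divides M Y"
proof -
  define f where "f y = (THE m. R y m)" for y
  have f: "f y = m" if "R y m" for y m
    unfolding f_def using that uniq by blast
  let ?H = "{y. \<exists>m. R y m}"
  have "subsemigroup ?H Y"
    unfolding subsemigroup_def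
  proof (intro conjI ballI)
    show "?H \<subseteq> carrier Y"
      using assms(2) by blast
    show "?H \<noteq> {}"
      using assms(1) onto by blast
    show "y \<otimes>\<^bsub>Y\<^esub> y' \<in> ?H" if "y \<in> ?H" "y' \<in> ?H" for y y'
      using that mult by blast
  qed
  moreover have "f \<in> epi (Y\<lparr>carrier := ?H\<rparr>) M"
    unfolding epi_def hom_def
  proof (intro CollectI conjI ballI Pi_I)
    show "f ` carrier (Y\<lparr>carrier := ?H\<rparr>) = carrier M"
    proof
      show "f ` carrier (Y\<lparr>carrier := ?H\<rparr>) \<subseteq> carrier M"
        using f assms(2) by auto
      show "carrier M \<subseteq> f ` carrier (Y\<lparr>carrier := ?H\<rparr>)"
      proof
        fix m assume "m \<in> carrier M"
        then obtain y where "R y m"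
          using onto by blast
        then show "m \<in> f ` carrier (Y\<lparr>carrier := ?H\<rparr>)"
          using f by force
      qed
    qed
  next
    fix y assume "y \<in> carrier (Y\<lparr>carrier := ?H\<rparr>)"
    then obtain m where m: "R y m"
      by auto
    then show "f y \<in> carrier M"
      using f assms(2) by auto
    fix y' assume "y' \<in> carrier (Y\<lparr>carrier := ?H\<rparr>)"
    then obtain m' where m': "R y' m'"
      by auto
    show "f (y \<otimes>\<^bsub>Y\<lparr>carrier := ?H\<rparr>\<^esub> y') = f y \<otimes>\<^bsub>M\<^esub> f y'"
      using f[OF mult[OF m m']] f[OF m] f[OF m'] by simp
  qed
  ultimately show ?thesis
    unfolding sgrp_divides_def by blast
qed

lemma sgrp_divides_trans:
  assumes "sgrp_divides S T" "sgrp_divides T U"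
  shows "sgrp_divides S U"
proof -
  obtain H f where "subsemigroup H T" and f: "f \<in> epi (T\<lparr>carrier := H\<rparr>) S"
    using assms(1) unfolding sgrp_divides_def by blast
  then have H: "H \<subseteq> carrier T" "H \<noteq> {}"
    "\<And>x y. x \<in> H \<Longrightarrow> y \<in> H \<Longrightarrow> x \<otimes>\<^bsub>T\<^esub> y \<in> H"
    by (auto simp: subsemigroup_def)
  have fm: "f (x \<otimes>\<^bsub>T\<^esub> y) = f x \<otimes>\<^bsub>S\<^esub> f y" if "x \<in> H" "y \<in> H" for x y
    using f that by (auto simp: epi_def hom_def)
  have fH: "f ` H = carrier S"
    using f by (simp add: epi_def)
  obtain K g where "subsemigroup K U" and g: "g \<in> epi (U\<lparr>carrier := K\<rparr>) T"
    using assms(2) unfolding sgrp_divides_def by blast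
  then have K: "K \<subseteq> carrier U"
    "\<And>x y. x \<in> K \<Longrightarrow> y \<in> K \<Longrightarrow> x \<otimes>\<^bsub>U\<^esub> y \<in> K"
    by (auto simp: subsemigroup_def)
  have gm: "g (x \<otimes>\<^bsub>U\<^esub> y) = g x \<otimes>\<^bsub>T\<^esub> g y" if "x \<in> K" "y \<in> K" for x y
    using g that by (auto simp: epi_def hom_def)
  have gK: "g ` K = carrier T"
    using g by (simp add: epi_def)
  show ?thesis
  proof (rule sgrp_divides_by_relation[where R = "\<lambda>y m. y \<in> K \<and> g y \<in> H \<and> m = f (g y)"])
    show "\<exists>y. y \<in> K \<and> g y \<in> H \<and> m = f (g y)" if "m \<in> carrier S" for m
    proof -
      from that have "m \<in> f ` H"
        by (simp add: fH)
      then obtain x where x: "x \<in> H" "m = f x"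
        by blast
      then have "x \<in> g ` K"
        using H(1) by (auto simp: gK)
      with x show ?thesis
        by blast
    qed
    have "f ` H \<noteq> {}"
      using H(2) by simp
    then show "carrier S \<noteq> {}"
      by (simp add: fH)
    show "y \<in> carrier U \<and> m \<in> carrier S" if "y \<in> K \<and> g y \<in> H \<and> m = f (g y)" for y m
      using that K(1) by (auto simp flip: fH)
    fix y m y' m'
    assume "y \<in> K \<and> g y \<in> H \<and> m = f (g y)" "y' \<in> K \<and> g y' \<in> H \<and> m' = f (g y')"
    then show "y \<otimes>\<^bsub>U\<^esub> y' \<in> K \<and> g (y \<otimes>\<^bsub>U\<^esub> y') \<in> H \<and> m \<otimes>\<^bsub>S\<^esub> m' = f (g (y \<otimes>\<^bsub>U\<^esub> y'))"
      by (simp add: K(2) gm fm H(3))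
  qed simp
qed

lemma sgrp_divides_epi:
  assumes "h \<in> epi T U" "fin_semigroup T"
  shows "sgrp_divides U T"
proof -
  have "subsemigroup (carrier T) T"
    using assms(2) by (simp add: fin_semigroup_def subsemigroup_def)
  moreover have "epi (T\<lparr>carrier := carrier T\<rparr>) U \<noteq> {}"
    using assms(1) by auto
  ultimately show ?thesis
    unfolding sgrp_divides_def by blast
qed

lemma sgrp_divides_inj_hom:
  assumes "h \<in> hom S T" "inj_on h (carrier S)" "fin_semigroup S"
  shows "sgrp_divides S T"
proof (rule sgrp_divides_by_relation[where R = "\<lambda>y m. m \<in> carrier S \<and> y = h m"])
  fix y m y' m'
  assume "m \<in> carrier S \<and> y = h m" "m' \<in> carrier S \<and> y' = h m'"
  then show "m \<otimes>\<^bsub>S\<^esub> m' \<in> carrier S \<and> y \<otimes>\<^bsub>T\<^esub> y' = h (m \<otimes>\<^bsub>S\<^esub> m')"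
    using assms(1,3) by (simp add: hom_def fin_semigroup_def)
next
  fix y m m'
  assume "m \<in> carrier S \<and> y = h m" "m' \<in> carrier S \<and> y = h m'"
  then show "m = m'"
    using assms(2) by (simp add: inj_on_def)
qed (use assms(1,3) in \<open>auto simp: hom_def fin_semigroup_def\<close>)

lemma sgrp_divides_subsemigroup:
  assumes "subsemigroup H T"
  shows "sgrp_divides (T\<lparr>carrier := H\<rparr>) T"
  by (rule sgrp_divides_by_relation[where R = "\<lambda>y m. m \<in> H \<and> y = m"])
    (use assms in \<open>auto simp: subsemigroup_def\<close>)

lemma fin_semigroup_divides:
  assumes "sgrp_divides S T" "fin_semigroup T"
  shows "fin_semigroup S"
proof -
  obtain H h where H: "subsemigroup H T" "h \<in> epi (T\<lparr>carrier := H\<rparr>) S"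
    using assms(1) unfolding sgrp_divides_def by blast
  then have "fin_semigroup (T\<lparr>carrier := H\<rparr>)"
    using assms(2)
    by (auto simp: fin_semigroup_def subsemigroup_def subset_iff intro: finite_subset)
  then show ?thesis
    using H(2) fin_semigroup_epi_image by blast
qed

lemma (in monoid) fin_semigroup_monoid: "finite (carrier G) \<Longrightarrow> fin_semigroup G"
  by (auto simp: fin_semigroup_def m_assoc)

section \<open>Closure properties over arbitrary types\<close>

text \<open>
  Membership is stated by \<open>in_class\<close> in what follows, since the constructions below leave the type
  \<^typ>\<open>nat\<close>: the closure properties of a class over \<^typ>\<open>nat\<close> are transported along isomorphisms.
\<close>
lemma in_classI: "U \<in> C \<Longrightarrow> h \<in> iso U S \<Longrightarrow> in_class S C"
  unfolding in_class_def is_iso_def by blast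

lemma in_classE:
  assumes "in_class S C"
  obtains U h where "U \<in> C" "h \<in> iso U S"
  using assms unfolding in_class_def is_iso_def by blast

locale semidirect_variety =
  fixes C :: "nat monoid set"
  assumes variety: "variety C"
    and closed: "closed_under_two_sided_semidirect C"
    and semilattices: "\<And>L :: nat monoid. fin_semilattice L \<Longrightarrow> L \<in> C"
begin

lemma fin_semigroup_member: "T \<in> C \<Longrightarrow> fin_semigroup T"
  and subsemigroup_member: "T \<in> C \<Longrightarrow> subsemigroup H T \<Longrightarrow> in_class (T\<lparr>carrier := H\<rparr>) C"
  and epi_image_member: "T \<in> C \<Longrightarrow> h \<in> epi T U \<Longrightarrow> U \<in> C"
  using variety unfolding variety_def by blast+

lemma product_member:
  assumes "\<And>i. i < (n::nat) \<Longrightarrow> F i \<in> C"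
  shows "in_class (product_group {..<n} F) C"
proof -
  have "\<forall>(n::nat) F. (\<forall>i<n. F i \<in> C) \<longrightarrow> in_class (product_group {..<n} F) C"
    using variety unfolding variety_def by blast
  then show ?thesis
    using assms by (elim allE[of _ n] allE[of _ F]) simp
qed

lemma fin_semigroup_in_class:
  assumes "in_class T C"
  shows "fin_semigroup T"
proof -
  obtain T0 g where "T0 \<in> C" "g \<in> iso T0 T"
    using assms(1) by (rule in_classE)
  then have "fin_semigroup T0" "g \<in> epi T0 T"
    by (auto simp: fin_semigroup_member iso_def epi_def bij_betw_def)
  then show ?thesis
    by (rule fin_semigroup_epi_image)
qed

lemma in_class_divides:
  assumes "in_class T C" "sgrp_divides S T"
  shows "in_class S C"
proof -
  obtain T0 g where T0: "T0 \<in> C" "g \<in> iso T0 T"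
    using assms(1) by (rule in_classE)
  then have "fin_semigroup T0" "g \<in> epi T0 T"
    by (auto simp: fin_semigroup_member iso_def epi_def bij_betw_def)
  then have TT0: "sgrp_divides T T0"
    by (metis sgrp_divides_epi)
  have "fin_semigroup S"
    by (rule fin_semigroup_divides[OF assms(2) fin_semigroup_in_class[OF assms(1)]])
  then obtain U :: "nat monoid" and h where U: "h \<in> iso U S" "fin_semigroup U"
    by (rule fin_semigroup_nat_copy)
  then have "sgrp_divides U S"
    by (intro sgrp_divides_inj_hom) (auto simp: iso_def bij_betw_def)
  then have "sgrp_divides U T0"
    by (rule sgrp_divides_trans[OF sgrp_divides_trans[OF _ assms(2)] TT0])
  then obtain H f where H: "subsemigroup H T0" "f \<in> epi (T0\<lparr>carrier := H\<rparr>) U"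
    unfolding sgrp_divides_def by blast
  have "in_class (T0\<lparr>carrier := H\<rparr>) C"
    using T0(1) H(1) by (rule subsemigroup_member)
  then obtain K k where K: "K \<in> C" "k \<in> iso K (T0\<lparr>carrier := H\<rparr>)"
    by (rule in_classE)
  have k: "k \<in> hom K (T0\<lparr>carrier := H\<rparr>)" "k ` carrier K = H"
    using K(2) by (auto simp: iso_def bij_betw_def)
  have "(f \<circ> k) ` carrier K = f ` (k ` carrier K)"
    by (rule image_comp[symmetric])
  also have "\<dots> = carrier U"
    unfolding k(2) using H(2) by (simp add: epi_def)
  finally have "f \<circ> k \<in> epi K U"
    using hom_compose[OF k(1)] H(2) unfolding epi_def by blast
  with K(1) have "U \<in> C"
    by (rule epi_image_member)
  then show ?thesis
    using U(1) by (rule in_classI)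
qed

text \<open>The actions are conjugated by isomorphisms onto members of the class over \<^typ>\<open>nat\<close>.\<close>
lemma in_class_two_sided_semidirect:
  assumes "in_class V C" "in_class W C" and a: "commuting_actions V W l r"
  shows "in_class (two_sided_semidirect V W l r) C"
proof -
  obtain V0 g where V0: "V0 \<in> C" "g \<in> iso V0 V"
    using assms(1) by (rule in_classE)
  obtain W0 k where W0: "W0 \<in> C" "k \<in> iso W0 W"
    using assms(2) by (rule in_classE)
  have fV0: "fin_semigroup V0" and fW0: "fin_semigroup W0"
    using V0(1) W0(1) fin_semigroup_member by blast+
  define g' where "g' = inv_into (carrier V0) g"
  have cl: "x \<otimes>\<^bsub>V0\<^esub> y \<in> carrier V0" if "x \<in> carrier V0" "y \<in> carrier V0" for x y
    using fV0 that by (simp add: fin_semigroup_def)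
  have gc: "g x \<in> carrier V" if "x \<in> carrier V0" for x
    using V0(2) that by (auto simp: iso_def bij_betw_def)
  have g'c: "g' v \<in> carrier V0" "g (g' v) = v" if "v \<in> carrier V" for v
    using V0(2) that by (auto simp: g'_def iso_def bij_betw_def inv_into_into f_inv_into_f)
  have g'g: "g' (g x) = x" if "x \<in> carrier V0" for x
    using V0(2) that by (auto simp: g'_def iso_def bij_betw_def)
  have gm: "g (x \<otimes>\<^bsub>V0\<^esub> y) = g x \<otimes>\<^bsub>V\<^esub> g y" if "x \<in> carrier V0" "y \<in> carrier V0" for x y
    using V0(2) that by (auto simp: iso_def hom_def)
  have g'm: "g' (x \<otimes>\<^bsub>V\<^esub> y) = g' x \<otimes>\<^bsub>V0\<^esub> g' y" if "x \<in> carrier V" "y \<in> carrier V" for x y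
    using gm[of "g' x" "g' y"] g'c that g'g cl by metis
  have kc: "k x \<in> carrier W" if "x \<in> carrier W0" for x
    using W0(2) that by (auto simp: iso_def bij_betw_def)
  have km: "k (x \<otimes>\<^bsub>W0\<^esub> y) = k x \<otimes>\<^bsub>W\<^esub> k y" if "x \<in> carrier W0" "y \<in> carrier W0" for x y
    using W0(2) that by (auto simp: iso_def hom_def)
  have lc: "l w v \<in> carrier V" and rc: "r v w \<in> carrier V"
    if "v \<in> carrier V" "w \<in> carrier W" for v w
    using a that by (auto simp: commuting_actions_def hom_def)
  have lh: "l w (v \<otimes>\<^bsub>V\<^esub> v') = l w v \<otimes>\<^bsub>V\<^esub> l w v'"
    and rh: "r (v \<otimes>\<^bsub>V\<^esub> v') w = r v w \<otimes>\<^bsub>V\<^esub> r v' w"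
    if "v \<in> carrier V" "v' \<in> carrier V" "w \<in> carrier W" for v v' w
    using a that by (auto simp: commuting_actions_def hom_def)
  have act: "l (w \<otimes>\<^bsub>W\<^esub> w') v = l w (l w' v)" "r v (w \<otimes>\<^bsub>W\<^esub> w') = r (r v w) w'"
    "r (l w v) w' = l w (r v w')"
    if "v \<in> carrier V" "w \<in> carrier W" "w' \<in> carrier W" for v w w'
    using a that by (auto simp: commuting_actions_def)
  define l0 where "l0 w v = g' (l (k w) (g v))" for w v
  define r0 where "r0 v w = g' (r (g v) (k w))" for w v
  have a0: "commuting_actions V0 W0 l0 r0"
    unfolding commuting_actions_def hom_def
    by (simp add: l0_def r0_def gc g'c g'm gm kc km lc rc lh rh act)
  then have "in_class (two_sided_semidirect V0 W0 l0 r0) C"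
    using closed V0(1) W0(1) by (simp add: closed_under_two_sided_semidirect_def)
  moreover have "sgrp_divides (two_sided_semidirect V W l r) (two_sided_semidirect V0 W0 l0 r0)"
  proof (rule sgrp_divides_epi)
    show "map_prod g k \<in> epi (two_sided_semidirect V0 W0 l0 r0) (two_sided_semidirect V W l r)"
    proof -
      have "g ` carrier V0 = carrier V" "k ` carrier W0 = carrier W"
        using V0(2) W0(2) by (auto simp: iso_def bij_betw_def)
      then have "map_prod g k ` (carrier V0 \<times> carrier W0) = carrier V \<times> carrier W"
        by (metis map_prod_surj_on)
      then show ?thesis
        by (auto simp: epi_def hom_def two_sided_semidirect_def l0_def r0_def
            gc g'c gm kc km lc rc)
    qed
    show "fin_semigroup (two_sided_semidirect V0 W0 l0 r0)"
      by (rule fin_semigroup_two_sided_semidirect[OF fV0 fW0 a0])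
  qed
  ultimately show ?thesis
    by (rule in_class_divides)
qed

lemma in_class_DirProd:
  assumes "in_class V C" "in_class W C"
  shows "in_class (DirProd V W) C"
proof -
  have "commuting_actions V W (\<lambda>w v. v) (\<lambda>v w. v)"
    by (auto simp: commuting_actions_def hom_def)
  moreover have "two_sided_semidirect V W (\<lambda>w v. v) (\<lambda>v w. v) = DirProd V W"
    by (simp add: two_sided_semidirect_def DirProd_def)
  ultimately show ?thesis
    using in_class_two_sided_semidirect[OF assms] by metis
qed

lemma in_class_power:
  assumes "in_class B C" "finite Q"
  shows "in_class (product_group Q (\<lambda>_. B)) C"
proof -
  obtain B0 g where B0: "B0 \<in> C" "g \<in> iso B0 B"
    using assms(1) by (rule in_classE)
  have fB0: "fin_semigroup B0"
    using B0(1) fin_semigroup_member by blast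
  obtain b :: "nat \<Rightarrow> _" where b: "bij_betw b {..<card Q} Q"
    using ex_bij_betw_nat_finite[OF assms(2)] by (auto simp: atLeast0LessThan)
  let ?P = "product_group {..<card Q} (\<lambda>_. B0)" and ?b = "inv_into {..<card Q} b"
  have b': "?b q < card Q" "b (?b q) = q" if "q \<in> Q" for q
    using that b bij_betw_inv_into_right[OF b that] inv_into_into[of q b "{..<card Q}"]
    by (auto simp: bij_betw_def)
  have bQ: "b i \<in> Q" "?b (b i) = i" if "i < card Q" for i
    using that b bij_betw_inv_into_left[OF b] by (auto simp: bij_betw_def)
  have gc: "g x \<in> carrier B" if "x \<in> carrier B0" for x
    using B0(2) that by (auto simp: iso_def bij_betw_def)
  have gm: "g (x \<otimes>\<^bsub>B0\<^esub> y) = g x \<otimes>\<^bsub>B\<^esub> g y" if "x \<in> carrier B0" "y \<in> carrier B0" for x y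
    using B0(2) that by (auto simp: iso_def hom_def)
  have gs: "inv_into (carrier B0) g x \<in> carrier B0" "g (inv_into (carrier B0) g x) = x"
    if "x \<in> carrier B" for x
    using B0(2) that by (auto simp: iso_def bij_betw_def inv_into_into f_inv_into_f)
  have "in_class ?P C"
    using B0(1) by (intro product_member) simp
  moreover have "sgrp_divides (product_group Q (\<lambda>_. B)) ?P"
  proof (rule sgrp_divides_epi)
    let ?h = "\<lambda>f. \<lambda>q\<in>Q. g (f (?b q))"
    have hom: "?h \<in> hom ?P (product_group Q (\<lambda>_. B))"
    proof (rule homI)
      show "?h f \<in> carrier (product_group Q (\<lambda>_. B))" if "f \<in> carrier ?P" for f
        using that b'(1) gc by (auto simp: PiE_iff)
      show "?h (f \<otimes>\<^bsub>?P\<^esub> f') = ?h f \<otimes>\<^bsub>product_group Q (\<lambda>_. B)\<^esub> ?h f'"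
        if "f \<in> carrier ?P" "f' \<in> carrier ?P" for f f'
        using that b'(1) gm by (auto simp: PiE_iff)
    qed
    have "carrier (product_group Q (\<lambda>_. B)) \<subseteq> ?h ` carrier ?P"
    proof
      fix F assume "F \<in> carrier (product_group Q (\<lambda>_. B))"
      then have F: "\<And>q. q \<in> Q \<Longrightarrow> F q \<in> carrier B" and ext: "F \<in> extensional Q"
        by (auto simp: PiE_iff)
      let ?f = "\<lambda>i\<in>{..<card Q}. inv_into (carrier B0) g (F (b i))"
      show "F \<in> ?h ` carrier ?P"
      proof
        show "F = ?h ?f"
          by (rule extensionalityI[OF ext]) (simp_all add: b' gs F)
        show "?f \<in> carrier ?P"
          by (auto simp: gs F bQ)
      qed
    qed
    moreover have "?h ` carrier ?P \<subseteq> carrier (product_group Q (\<lambda>_. B))"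
      by (rule hom_carrier[OF hom])
    ultimately show "?h \<in> epi ?P (product_group Q (\<lambda>_. B))"
      unfolding epi_def by (intro CollectI conjI equalityI hom)
    show "fin_semigroup ?P"
      by (simp add: fB0 fin_semigroup_product)
  qed
  ultimately show ?thesis
    by (rule in_class_divides)
qed

lemma in_class_semilattice:
  assumes "fin_semilattice L"
  shows "in_class L C"
proof -
  have "fin_semigroup L"
    using assms by (simp add: fin_semilattice_def)
  then obtain U :: "nat monoid" and h where U: "h \<in> iso U L" "fin_semigroup U"
    by (rule fin_semigroup_nat_copy)
  have hU: "h x \<in> carrier L" if "x \<in> carrier U" for x
    using U(1) that by (auto simp: iso_def bij_betw_def)
  have inj: "x = y" if "h x = h y" "x \<in> carrier U" "y \<in> carrier U" for x y
    using U(1) that by (auto simp: iso_def bij_betw_def inj_on_def)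
  have hm: "h (x \<otimes>\<^bsub>U\<^esub> y) = h x \<otimes>\<^bsub>L\<^esub> h y" if "x \<in> carrier U" "y \<in> carrier U" for x y
    using U(1) that by (auto simp: iso_def hom_def)
  have cl: "x \<otimes>\<^bsub>U\<^esub> y \<in> carrier U" if "x \<in> carrier U" "y \<in> carrier U" for x y
    using U(2) that by (simp add: fin_semigroup_def)
  have "fin_semilattice U"
    unfolding fin_semilattice_def
  proof (intro conjI ballI)
    show "x \<otimes>\<^bsub>U\<^esub> y = y \<otimes>\<^bsub>U\<^esub> x" if "x \<in> carrier U" "y \<in> carrier U" for x y
      using assms that by (intro inj) (simp_all add: hm hU cl fin_semilattice_def)
    show "x \<otimes>\<^bsub>U\<^esub> x = x" if "x \<in> carrier U" for x
      using assms that by (intro inj) (simp_all add: hm hU cl fin_semilattice_def)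
  qed (rule U(2))
  then show ?thesis
    using in_classI[OF semilattices U(1)] by simp
qed

text \<open>
  Wreath products are the main tool for both inductive steps. An element \<open>(f, w)\<close> is read as a
  transducer: it moves the state \<open>q\<close> to \<open>act q w\<close> and outputs \<open>f q\<close>, and a product multiplies the
  outputs along the way.
\<close>
lemma in_class_wreath:
  assumes "in_class B C" "in_class W C" "finite Q"
    and act: "\<And>q w. q \<in> Q \<Longrightarrow> w \<in> carrier W \<Longrightarrow> act q w \<in> Q"
      "\<And>q w w'. q \<in> Q \<Longrightarrow> w \<in> carrier W \<Longrightarrow> w' \<in> carrier W \<Longrightarrow>
        act q (w \<otimes>\<^bsub>W\<^esub> w') = act (act q w) w'"
  shows "in_class (two_sided_semidirect (product_group Q (\<lambda>_. B)) W
           (\<lambda>w f. \<lambda>q\<in>Q. f (act q w)) (\<lambda>f w. f)) C"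
proof (rule in_class_two_sided_semidirect)
  show "in_class (product_group Q (\<lambda>_. B)) C"
    by (rule in_class_power[OF assms(1,3)])
  show "commuting_actions (product_group Q (\<lambda>_. B)) W
          (\<lambda>w f. \<lambda>q\<in>Q. f (act q w)) (\<lambda>f w. f)"
    unfolding commuting_actions_def
    by (intro conjI ballI homI) (auto simp: act PiE_iff)
qed (rule assms)

section \<open>Groups and their extensions\<close>

lemma in_class_simple_group:
  assumes "simple_group M"
    and simple: "\<And>G :: nat monoid. simple_group G \<Longrightarrow> sgrp_divides G M \<Longrightarrow> G \<in> C"
  shows "in_class M C"
proof -
  interpret simple_group M by fact
  have fin: "finite (carrier M)"
    using order_gt_one by (auto simp: order_def intro: card_ge_0_finite)
  then obtain \<phi> :: "'a \<Rightarrow> nat" where \<phi>: "inj_on \<phi> (carrier M)"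
    using finite_imp_inj_to_nat_seg by blast
  let ?g = "inv_into (carrier M) \<phi>"
  define U :: "nat monoid" where
    "U = \<lparr>carrier = \<phi> ` carrier M, monoid.mult = (\<lambda>x y. \<phi> (?g x \<otimes>\<^bsub>M\<^esub> ?g y)), one = \<phi> \<one>\<^bsub>M\<^esub>\<rparr>"
  have hom: "\<phi> \<in> hom M U"
    using \<phi> by (auto simp: hom_def U_def)
  then have iso: "\<phi> \<in> iso M U"
    using \<phi> by (auto simp: iso_def bij_betw_def U_def)
  moreover have "group U"
    using hom_imp_img_group[OF hom] by (simp add: U_def)
  ultimately have U: "simple_group U"
    by (rule iso_simple[rotated])
  have f: "fin_semigroup M"
    using fin by (rule fin_semigroup_monoid)
  have "\<phi> \<in> epi M U"
    using iso by (auto simp: iso_def epi_def bij_betw_def)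
  then have "U \<in> C"
    by (intro simple[OF U] sgrp_divides_epi[OF _ f])
  then have "in_class U C"
    using iso_set_refl by (rule in_classI)
  then show ?thesis
    using sgrp_divides_inj_hom[OF hom \<phi> f] by (rule in_class_divides)
qed

end

text \<open>
  The quotient by a normal subgroup is realised on coset representatives, not on cosets, so that it
  has the same element type as the group and the induction hypothesis applies to it.
\<close>
definition coset_rep :: "('a, 'b) monoid_scheme \<Rightarrow> 'a set \<Rightarrow> 'a \<Rightarrow> 'a" where
  "coset_rep M N x = (SOME y. y \<in> carrier M \<and> y \<otimes>\<^bsub>M\<^esub> inv\<^bsub>M\<^esub> x \<in> N)"

definition transversal_quotient :: "('a, 'b) monoid_scheme \<Rightarrow> 'a set \<Rightarrow> 'a monoid" where
  "transversal_quotient M N =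
     \<lparr>carrier = coset_rep M N ` carrier M,
      monoid.mult = (\<lambda>x y. coset_rep M N (x \<otimes>\<^bsub>M\<^esub> y)), one = coset_rep M N \<one>\<^bsub>M\<^esub>\<rparr>"

context normal
begin

abbreviation (input) "rep \<equiv> coset_rep G H"

lemma coset_rep:
  assumes "x \<in> carrier G"
  shows coset_rep_closed: "rep x \<in> carrier G"
    and coset_rep_in: "rep x \<otimes> inv x \<in> H"
proof -
  have "rep x \<in> carrier G \<and> rep x \<otimes> inv x \<in> H"
    unfolding coset_rep_def by (rule someI[of _ x]) (use assms in simp)
  then show "rep x \<in> carrier G" "rep x \<otimes> inv x \<in> H"
    by auto
qed

lemma coset_rep_eq:
  assumes x: "x \<in> carrier G" and y: "y \<in> carrier G" and yx: "y \<otimes> inv x \<in> H"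
  shows "rep x = rep y"
proof -
  have "z \<otimes> inv x \<in> H \<longleftrightarrow> z \<otimes> inv y \<in> H" if z: "z \<in> carrier G" for z
  proof
    assume "z \<otimes> inv y \<in> H"
    then have "(z \<otimes> inv y) \<otimes> (y \<otimes> inv x) \<in> H"
      using yx by (rule subgroup.m_closed[OF subgroup_axioms])
    moreover have "inv y \<otimes> (y \<otimes> inv x) = inv x"
      using x y by (simp flip: m_assoc)
    ultimately show "z \<otimes> inv x \<in> H"
      using x y z by (simp add: m_assoc)
  next
    assume "z \<otimes> inv x \<in> H"
    then have "(z \<otimes> inv x) \<otimes> inv (y \<otimes> inv x) \<in> H"
      using yx by simp
    moreover have "inv (y \<otimes> inv x) = x \<otimes> inv y"
      using x y by (simp add: inv_mult_group)
    moreover have "inv x \<otimes> (x \<otimes> inv y) = inv y"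
      using x y by (simp flip: m_assoc)
    ultimately show "z \<otimes> inv y \<in> H"
      using x y z by (simp add: m_assoc)
  qed
  then have "(\<lambda>z. z \<in> carrier G \<and> z \<otimes> inv x \<in> H) = (\<lambda>z. z \<in> carrier G \<and> z \<otimes> inv y \<in> H)"
    by auto
  then show ?thesis
    unfolding coset_rep_def by simp
qed

lemma coset_rep_mult:
  assumes xy: "x \<in> carrier G" "y \<in> carrier G"
  shows coset_rep_mult_right: "rep (x \<otimes> rep y) = rep (x \<otimes> y)"
    and coset_rep_mult_left: "rep (rep x \<otimes> y) = rep (x \<otimes> y)"
proof -
  have "x \<otimes> rep y \<otimes> inv (x \<otimes> y) = x \<otimes> (rep y \<otimes> inv y) \<otimes> inv x"
    using xy coset_rep_closed by (simp add: inv_mult_group m_assoc)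
  also have "\<dots> \<in> H"
    using xy coset_rep_in by (intro inv_op_closed2)
  finally have "rep (x \<otimes> y) = rep (x \<otimes> rep y)"
    by (intro coset_rep_eq m_closed xy coset_rep_closed)
  then show "rep (x \<otimes> rep y) = rep (x \<otimes> y)" ..
  have "y \<otimes> inv (x \<otimes> y) = inv x"
    using xy by (simp add: inv_mult_group flip: m_assoc)
  then have "rep x \<otimes> y \<otimes> inv (x \<otimes> y) = rep x \<otimes> inv x"
    using xy coset_rep_closed by (simp add: m_assoc)
  also have "\<dots> \<in> H"
    using xy(1) by (rule coset_rep_in)
  finally have "rep (x \<otimes> y) = rep (rep x \<otimes> y)"
    by (intro coset_rep_eq m_closed xy coset_rep_closed)
  then show "rep (rep x \<otimes> y) = rep (x \<otimes> y)" ..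
qed

lemma coset_rep_epi: "rep \<in> epi G (transversal_quotient G H)"
  unfolding epi_def
proof (intro CollectI conjI homI)
  fix x y assume "x \<in> carrier G" "y \<in> carrier G"
  then show "rep (x \<otimes> y) = rep x \<otimes>\<^bsub>transversal_quotient G H\<^esub> rep y"
    by (simp add: transversal_quotient_def coset_rep_mult coset_rep_closed)
qed (auto simp: transversal_quotient_def)

lemma monoid_transversal_quotient: "monoid (transversal_quotient G H)"
proof -
  have "rep \<in> hom G (transversal_quotient G H)"
    using coset_rep_epi by (simp add: epi_def)
  then have "monoid (transversal_quotient G H
      \<lparr>carrier := rep ` carrier G, one := rep \<one>\<rparr>)"
    by (rule hom_imp_img_monoid)
  then show ?thesis
    by (simp add: transversal_quotient_def)
qed

lemma card_transversal_quotient_less: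
  assumes "finite (carrier G)" "H \<noteq> {\<one>}"
  shows "card (carrier (transversal_quotient G H)) < card (carrier G)"
proof -
  obtain h where h: "h \<in> H" "h \<noteq> \<one>"
    using assms(2) subgroup.one_closed[OF subgroup_axioms] by blast
  then have "h \<in> carrier G"
    using subset by blast
  then have "rep \<one> = rep h"
    using h by (intro coset_rep_eq) simp_all
  then have "\<not> inj_on rep (carrier G)"
    using h(2) \<open>h \<in> carrier G\<close> by (auto dest!: inj_onD)
  then have "card (rep ` carrier G) \<noteq> card (carrier G)"
    using assms(1) eq_card_imp_inj_on by blast
  then show ?thesis
    using card_image_le[OF assms(1), of rep] by (simp add: transversal_quotient_def)
qed

end

context semidirect_variety
begin

text \<open>
  The Krasner-Kaloujnine embedding into the wreath product of \<open>N\<close> by the quotient: \<open>g\<close> moves the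
  representative \<open>q\<close> to the representative of \<open>qg\<close>, and the correction \<open>q g \<cdot> inv (rep (q g))\<close> lies in \<open>N\<close>.
  These corrections telescope along products, and together with \<open>rep g\<close> they determine \<open>g\<close>.
\<close>
lemma in_class_extension:
  assumes "N \<lhd> M" and fin: "finite (carrier M)"
    and N: "in_class (M\<lparr>carrier := N\<rparr>) C"
    and Q: "in_class (transversal_quotient M N) C"
  shows "in_class M C"
proof -
  interpret normal N M by fact
  define t where "t = coset_rep M N"
  note t = coset_rep_closed[folded t_def] coset_rep_in[folded t_def] coset_rep_eq[folded t_def]
  note tt = coset_rep_mult[folded t_def]
  let ?Q = "transversal_quotient M N"
  have Q_simps: "carrier ?Q = t ` carrier M" "x \<otimes>\<^bsub>?Q\<^esub> y = t (x \<otimes>\<^bsub>M\<^esub> y)" for x y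
    by (simp_all add: transversal_quotient_def t_def)
  let ?act = "\<lambda>q w. t (q \<otimes>\<^bsub>M\<^esub> w)"
  let ?T = "t ` carrier M"
  have T: "q \<in> carrier M" if "q \<in> ?T" for q
    using that t(1) by blast
  let ?Y = "two_sided_semidirect (product_group ?T (\<lambda>_. M\<lparr>carrier := N\<rparr>)) ?Q
           (\<lambda>w f. \<lambda>q\<in>?T. f (?act q w)) (\<lambda>f w. f)"
  have Y: "in_class ?Y C"
    using N Q
  proof (rule in_class_wreath)
    show "finite ?T"
      using fin by simp
    fix q w assume q: "q \<in> ?T" and w: "w \<in> carrier ?Q"
    then have qw: "q \<in> carrier M" "w \<in> carrier M"
      using T by (simp_all add: Q_simps)
    show "?act q w \<in> ?T"
      using qw by simp
    fix w' assume "w' \<in> carrier ?Q"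
    then have w': "w' \<in> carrier M"
      using T by (simp add: Q_simps)
    have "t (q \<otimes>\<^bsub>M\<^esub> t (w \<otimes>\<^bsub>M\<^esub> w')) = t (t (q \<otimes>\<^bsub>M\<^esub> w) \<otimes>\<^bsub>M\<^esub> w')"
      using qw w' tt(1)[of q "w \<otimes>\<^bsub>M\<^esub> w'"] tt(2)[of "q \<otimes>\<^bsub>M\<^esub> w" w'] by (simp add: m_assoc)
    then show "?act q (w \<otimes>\<^bsub>?Q\<^esub> w') = ?act (?act q w) w'"
      by (simp add: Q_simps)
  qed
  let ?f = "\<lambda>g. \<lambda>q\<in>?T. q \<otimes>\<^bsub>M\<^esub> g \<otimes>\<^bsub>M\<^esub> inv\<^bsub>M\<^esub> (t (q \<otimes>\<^bsub>M\<^esub> g))"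
  have fN: "q \<otimes>\<^bsub>M\<^esub> g \<otimes>\<^bsub>M\<^esub> inv\<^bsub>M\<^esub> (t (q \<otimes>\<^bsub>M\<^esub> g)) \<in> N"
    if q: "q \<in> carrier M" and g: "g \<in> carrier M" for q g
  proof -
    have "t (q \<otimes>\<^bsub>M\<^esub> g) \<otimes>\<^bsub>M\<^esub> inv\<^bsub>M\<^esub> (q \<otimes>\<^bsub>M\<^esub> g) \<in> N"
      by (intro t(2) m_closed q g)
    then have "inv\<^bsub>M\<^esub> (t (q \<otimes>\<^bsub>M\<^esub> g) \<otimes>\<^bsub>M\<^esub> inv\<^bsub>M\<^esub> (q \<otimes>\<^bsub>M\<^esub> g)) \<in> N"
      by simp
    also have "inv\<^bsub>M\<^esub> (t (q \<otimes>\<^bsub>M\<^esub> g) \<otimes>\<^bsub>M\<^esub> inv\<^bsub>M\<^esub> (q \<otimes>\<^bsub>M\<^esub> g)) = q \<otimes>\<^bsub>M\<^esub> g \<otimes>\<^bsub>M\<^esub> inv\<^bsub>M\<^esub> (t (q \<otimes>\<^bsub>M\<^esub> g))"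
      using q g by (subst inv_mult_group) (simp_all add: t(1))
    finally show ?thesis .
  qed
  have f_mult: "?f (g \<otimes>\<^bsub>M\<^esub> h) q = ?f g q \<otimes>\<^bsub>M\<^esub> ?f h (?act q (t g))"
    if gh: "g \<in> carrier M" "h \<in> carrier M" and q: "q \<in> ?T" for g h q
  proof -
    define s where "s = t (q \<otimes>\<^bsub>M\<^esub> g)"
    define s' where "s' = t (q \<otimes>\<^bsub>M\<^esub> g \<otimes>\<^bsub>M\<^esub> h)"
    note qM = T[OF q]
    have s: "s \<in> carrier M" "s' \<in> carrier M" "s \<in> ?T"
      using gh qM by (auto simp: s_def s'_def t(1))
    have act: "?act q (t g) = s" "t (s \<otimes>\<^bsub>M\<^esub> h) = s'"
      using gh qM by (simp_all add: s_def s'_def tt)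
    have "?f h s = s \<otimes>\<^bsub>M\<^esub> h \<otimes>\<^bsub>M\<^esub> inv\<^bsub>M\<^esub> s'"
      using s by (simp add: act)
    moreover have "?f g q = q \<otimes>\<^bsub>M\<^esub> g \<otimes>\<^bsub>M\<^esub> inv\<^bsub>M\<^esub> s"
      using q by (simp add: s_def)
    moreover have "?f (g \<otimes>\<^bsub>M\<^esub> h) q = q \<otimes>\<^bsub>M\<^esub> g \<otimes>\<^bsub>M\<^esub> h \<otimes>\<^bsub>M\<^esub> inv\<^bsub>M\<^esub> s'"
      using q qM gh by (simp add: s'_def m_assoc)
    moreover have "inv\<^bsub>M\<^esub> s \<otimes>\<^bsub>M\<^esub> (s \<otimes>\<^bsub>M\<^esub> (h \<otimes>\<^bsub>M\<^esub> inv\<^bsub>M\<^esub> s')) = h \<otimes>\<^bsub>M\<^esub> inv\<^bsub>M\<^esub> s'"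
      using s gh by (simp flip: m_assoc)
    ultimately show ?thesis
      unfolding act(1) using s gh qM by (simp add: m_assoc)
  qed
  have "sgrp_divides M ?Y"
  proof (rule sgrp_divides_inj_hom)
    show "(\<lambda>g. (?f g, t g)) \<in> hom M ?Y"
    proof (rule homI)
      show "(?f g, t g) \<in> carrier ?Y" if "g \<in> carrier M" for g
        using that fN T by (auto simp: two_sided_semidirect_def Q_simps)
      fix g h assume gh: "g \<in> carrier M" "h \<in> carrier M"
      have "?f (g \<otimes>\<^bsub>M\<^esub> h) = (\<lambda>q\<in>?T. ?f g q \<otimes>\<^bsub>M\<^esub> (\<lambda>q\<in>?T. ?f h (?act q (t g))) q)"
        using f_mult[OF gh] by (intro extensionalityI[where A = ?T]) simp_all
      moreover have "t (g \<otimes>\<^bsub>M\<^esub> h) = t (t g \<otimes>\<^bsub>M\<^esub> t h)"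
        using gh by (simp add: tt t(1))
      ultimately show "(?f (g \<otimes>\<^bsub>M\<^esub> h), t (g \<otimes>\<^bsub>M\<^esub> h)) = (?f g, t g) \<otimes>\<^bsub>?Y\<^esub> (?f h, t h)"
        by (simp only: two_sided_semidirect_def monoid.simps mult_product_group split Q_simps) simp
    qed
    show "inj_on (\<lambda>g. (?f g, t g)) (carrier M)"
    proof (rule inj_onI)
      fix g h assume gh: "g \<in> carrier M" "h \<in> carrier M" and "(?f g, t g) = (?f h, t h)"
      then have eq: "?f g = ?f h" "t g = t h"
        by blast+
      let ?q = "t \<one>\<^bsub>M\<^esub>"
      have q: "?q \<in> ?T" "?q \<in> carrier M"
        using t(1) by simp_all
      have "t (?q \<otimes>\<^bsub>M\<^esub> g) = t (?q \<otimes>\<^bsub>M\<^esub> h)"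
        using gh eq(2) tt(2)[of "\<one>\<^bsub>M\<^esub>" g] tt(2)[of "\<one>\<^bsub>M\<^esub>" h] by simp
      moreover have "?f g ?q = ?f h ?q"
        by (simp only: eq(1))
      ultimately have "?q \<otimes>\<^bsub>M\<^esub> g \<otimes>\<^bsub>M\<^esub> inv\<^bsub>M\<^esub> (t (?q \<otimes>\<^bsub>M\<^esub> h)) = ?q \<otimes>\<^bsub>M\<^esub> h \<otimes>\<^bsub>M\<^esub> inv\<^bsub>M\<^esub> (t (?q \<otimes>\<^bsub>M\<^esub> h))"
        using q(1) by simp
      then show "g = h"
        using gh q(2) t(1) by simp
    qed
    show "fin_semigroup M"
      using fin by (rule fin_semigroup_monoid)
  qed
  with Y show ?thesis
    by (rule in_class_divides)
qed

end

section \<open>Local divisors\<close>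

text \<open>
  The product of \<open>uc\<close> and \<open>cv\<close> in the local divisor is \<open>ucv\<close>. The choice of the left factor \<open>u\<close> is
  harmless: the right argument lies in \<open>cM\<close>, so that only \<open>uc\<close> matters.
\<close>
definition local_divisor :: "('a, 'b) monoid_scheme \<Rightarrow> 'a \<Rightarrow> 'a monoid" where
  "local_divisor M c =
     \<lparr>carrier = {x. (\<exists>u\<in>carrier M. x = u \<otimes>\<^bsub>M\<^esub> c) \<and> (\<exists>v\<in>carrier M. x = c \<otimes>\<^bsub>M\<^esub> v)},
      monoid.mult = (\<lambda>x y. (SOME u. u \<in> carrier M \<and> x = u \<otimes>\<^bsub>M\<^esub> c) \<otimes>\<^bsub>M\<^esub> y), one = c\<rparr>"

context monoid
begin

lemma local_divisor_mult:
  assumes "u \<in> carrier G" "c \<in> carrier G" "v \<in> carrier G"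
  shows "(u \<otimes> c) \<otimes>\<^bsub>local_divisor G c\<^esub> (c \<otimes> v) = u \<otimes> c \<otimes> v"
proof -
  define u' where "u' = (SOME w. w \<in> carrier G \<and> u \<otimes> c = w \<otimes> c)"
  have u': "u' \<in> carrier G \<and> u \<otimes> c = u' \<otimes> c"
    unfolding u'_def by (rule someI[of _ u]) (use assms in simp)
  have "(u \<otimes> c) \<otimes>\<^bsub>local_divisor G c\<^esub> (c \<otimes> v) = u' \<otimes> (c \<otimes> v)"
    by (simp add: local_divisor_def u'_def)
  also have "\<dots> = (u' \<otimes> c) \<otimes> v"
    using u' assms by (simp add: m_assoc)
  finally show ?thesis
    using u' by simp
qed

lemma local_divisorE:
  assumes "x \<in> carrier (local_divisor G c)"
  obtains u v where "u \<in> carrier G" "v \<in> carrier G" "x = u \<otimes> c" "x = c \<otimes> v"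
  using assms by (auto simp: local_divisor_def)

lemma local_divisorI:
  assumes "u \<in> carrier G" "v \<in> carrier G" "x = u \<otimes> c" "x = c \<otimes> v"
  shows "x \<in> carrier (local_divisor G c)"
  unfolding local_divisor_def partial_object.simps mem_Collect_eq
  using assms by blast

lemma monoid_local_divisor:
  assumes c: "c \<in> carrier G"
  shows "monoid (local_divisor G c)" (is "monoid ?L")
proof
  have one: "\<one>\<^bsub>?L\<^esub> = c"
    by (simp add: local_divisor_def)
  show "\<one>\<^bsub>?L\<^esub> \<in> carrier ?L"
    using c by (intro local_divisorI[of \<one> \<one>]) (auto simp: one)
  fix x assume "x \<in> carrier ?L"
  then obtain u u' where u: "u \<in> carrier G" "u' \<in> carrier G" "x = u \<otimes> c" "x = c \<otimes> u'"
    by (rule local_divisorE)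
  show "\<one>\<^bsub>?L\<^esub> \<otimes>\<^bsub>?L\<^esub> x = x"
    using local_divisor_mult[of \<one> c u'] u c by (simp add: one)
  show "x \<otimes>\<^bsub>?L\<^esub> \<one>\<^bsub>?L\<^esub> = x"
    using local_divisor_mult[of u c \<one>] u c by (simp add: one)
  fix y assume "y \<in> carrier ?L"
  then obtain v v' where v: "v \<in> carrier G" "v' \<in> carrier G" "y = v \<otimes> c" "y = c \<otimes> v'"
    by (rule local_divisorE)
  have xy: "x \<otimes>\<^bsub>?L\<^esub> y = u \<otimes> c \<otimes> v'"
    using local_divisor_mult[of u c v'] u v c by simp
  have xy1: "x \<otimes>\<^bsub>?L\<^esub> y = (u \<otimes> v) \<otimes> c"
    unfolding xy using u v c by (metis m_assoc)
  have xy2: "x \<otimes>\<^bsub>?L\<^esub> y = c \<otimes> (u' \<otimes> v')"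
    unfolding xy using u v c by (metis m_assoc)
  show "x \<otimes>\<^bsub>?L\<^esub> y \<in> carrier ?L"
    by (rule local_divisorI[OF _ _ xy1 xy2]) (use u v in simp_all)
  fix z assume "z \<in> carrier ?L"
  then obtain w w' where w: "w \<in> carrier G" "w' \<in> carrier G" "z = w \<otimes> c" "z = c \<otimes> w'"
    by (rule local_divisorE)
  have yz: "y \<otimes>\<^bsub>?L\<^esub> z = c \<otimes> (v' \<otimes> w')"
    using local_divisor_mult[of v c w'] w v c by (metis m_assoc)
  have "x \<otimes>\<^bsub>?L\<^esub> y \<otimes>\<^bsub>?L\<^esub> z = (u \<otimes> v) \<otimes> c \<otimes> w'"
    unfolding xy1 using local_divisor_mult[of "u \<otimes> v" c w'] u v w c by simp
  also have "\<dots> = u \<otimes> c \<otimes> (v' \<otimes> w')"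
    using u v w c by (metis m_assoc m_closed)
  also have "\<dots> = x \<otimes>\<^bsub>?L\<^esub> (y \<otimes>\<^bsub>?L\<^esub> z)"
    unfolding yz using local_divisor_mult[of u c "v' \<otimes> w'"] u v w c by simp
  finally show "x \<otimes>\<^bsub>?L\<^esub> y \<otimes>\<^bsub>?L\<^esub> z = x \<otimes>\<^bsub>?L\<^esub> (y \<otimes>\<^bsub>?L\<^esub> z)" .
qed

text \<open>
  The elements \<open>x\<close> with \<open>cx \<in> Mc\<close> form a submonoid, on which \<open>x \<mapsto> cx\<close> is a homomorphism onto the local
  divisor: if \<open>cx = uc\<close>, then \<open>cx \<circ> cy = ucy = cxy\<close>.
\<close>
lemma local_divisor_divides:
  assumes c: "c \<in> carrier G"
  shows "sgrp_divides (local_divisor G c) G"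
proof (rule sgrp_divides_by_relation[where
      R = "\<lambda>x m. x \<in> carrier G \<and> m = c \<otimes> x \<and> m \<in> carrier (local_divisor G c)"])
  interpret L: monoid "local_divisor G c"
    using c by (rule monoid_local_divisor)
  show "carrier (local_divisor G c) \<noteq> {}"
    using L.one_closed by blast
  show "\<exists>x. x \<in> carrier G \<and> m = c \<otimes> x \<and> m \<in> carrier (local_divisor G c)"
    if "m \<in> carrier (local_divisor G c)" for m
    using that local_divisorE by metis
  fix x m y m'
  assume x: "x \<in> carrier G \<and> m = c \<otimes> x \<and> m \<in> carrier (local_divisor G c)"
    and y: "y \<in> carrier G \<and> m' = c \<otimes> y \<and> m' \<in> carrier (local_divisor G c)"
  obtain u where u: "u \<in> carrier G" "m = u \<otimes> c"
    using x local_divisorE by metis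
  have "m \<otimes>\<^bsub>local_divisor G c\<^esub> m' = c \<otimes> (x \<otimes> y)"
    using local_divisor_mult[of u c y] u x y c by (metis m_assoc)
  moreover have "m \<otimes>\<^bsub>local_divisor G c\<^esub> m' \<in> carrier (local_divisor G c)"
    using x y L.m_closed by blast
  ultimately show "x \<otimes> y \<in> carrier G \<and> m \<otimes>\<^bsub>local_divisor G c\<^esub> m' = c \<otimes> (x \<otimes> y) \<and>
      m \<otimes>\<^bsub>local_divisor G c\<^esub> m' \<in> carrier (local_divisor G c)"
    using x y by simp
qed auto

text \<open>The identity of the monoid is lost: \<open>\<one> = uc = cv\<close> would make \<open>c\<close> a unit.\<close>
lemma card_local_divisor_less:
  assumes "c \<in> carrier G" "c \<notin> Units G" "finite (carrier G)"
  shows "card (carrier (local_divisor G c)) < card (carrier G)"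
proof (rule psubset_card_mono)
  have "\<one> \<notin> carrier (local_divisor G c)"
  proof
    assume "\<one> \<in> carrier (local_divisor G c)"
    then obtain u v where uv: "u \<in> carrier G" "v \<in> carrier G" "\<one> = u \<otimes> c" "\<one> = c \<otimes> v"
      by (rule local_divisorE)
    then have "u = v"
      using inv_unique assms(1) by metis
    with uv assms(1,2) show False
      unfolding Units_def by auto
  qed
  moreover have "carrier (local_divisor G c) \<subseteq> carrier G"
    using assms(1) by (auto elim: local_divisorE)
  ultimately show "carrier (local_divisor G c) \<subset> carrier G"
    using one_closed by blast
qed (rule assms)

end

section \<open>Monoids generated by a submonoid and one non-unit\<close>

context semidirect_variety
begin

text \<open>
  The relation \<open>R\<close> in the proof says which elements of the wreath product represent an element of
  \<open>M\<close>. An \<open>n \<in> N\<close> is represented with the blocks \<open>(n, n)\<close> and the constant output \<open>c\<close>, the identity of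
  the local divisor \<open>L\<close>. An element \<open>a x b\<close> with \<open>a, b \<in> N\<close> and \<open>x \<in> L\<close> is represented with the blocks \<open>(a, b)\<close> and an
  output that depends on the state: \<open>x\<close> if no \<open>c\<close> has been read before, and otherwise, if \<open>b'\<close> is the
  last block read so far, the element \<open>c b' a x\<close>, which also closes the gap \<open>c b' a c\<close> to the left of
  \<open>x\<close>. Multiplying such representatives is the computation
  \<open>a x b \<cdot> a' x' b' = a (x \<circ> (c b a' x')) b'\<close>.
\<close>
lemma in_class_local_divisor_extension:
  assumes "monoid M" and fin: "finite (carrier M)"
    and "submonoid N M" and c: "c \<in> carrier M"
    and gen: "\<And>K. submonoid K M \<Longrightarrow> N \<subseteq> K \<Longrightarrow> c \<in> K \<Longrightarrow> K = carrier M"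
    and N: "in_class (M\<lparr>carrier := N\<rparr>) C"
    and L: "in_class (local_divisor M c) C"
  shows "in_class M C"
proof -
  interpret monoid M by fact
  let ?L = "local_divisor M c"
  interpret L: monoid ?L
    using c by (rule monoid_local_divisor)
  note N_sub = submonoid.subset[OF \<open>submonoid N M\<close>]
    and N_mult = submonoid.m_closed[OF \<open>submonoid N M\<close>]
    and N_one = submonoid.one_closed[OF \<open>submonoid N M\<close>]
  have N_M: "a \<in> carrier M" if "a \<in> N" for a
    using that N_sub by blast
  have L_one: "\<one>\<^bsub>?L\<^esub> = c"
    by (simp add: local_divisor_def)
  have L_M: "x \<in> carrier M" if "x \<in> carrier ?L" for x
    using that c by (auto elim: local_divisorE)
  have L_mult: "x \<otimes>\<^bsub>?L\<^esub> (c \<otimes>\<^bsub>M\<^esub> v) = x \<otimes>\<^bsub>M\<^esub> v" if x: "x \<in> carrier ?L" and v: "v \<in> carrier M" for x v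
  proof -
    obtain u where "u \<in> carrier M" "x = u \<otimes>\<^bsub>M\<^esub> c"
      using x by (rule local_divisorE)
    then show ?thesis
      using local_divisor_mult[of u c v] c v by simp
  qed
  have L_left: "c \<otimes>\<^bsub>M\<^esub> (v \<otimes>\<^bsub>M\<^esub> x) \<in> carrier ?L" if x: "x \<in> carrier ?L" and v: "v \<in> carrier M" for x v
  proof -
    obtain u where u: "u \<in> carrier M" "x = u \<otimes>\<^bsub>M\<^esub> c"
      using x by (rule local_divisorE)
    show ?thesis
      by (rule local_divisorI[where u = "c \<otimes>\<^bsub>M\<^esub> (v \<otimes>\<^bsub>M\<^esub> u)" and v = "v \<otimes>\<^bsub>M\<^esub> x"])
        (use u c v in \<open>simp_all add: m_assoc\<close>)
  qed
  let ?N = "M\<lparr>carrier := N\<rparr>"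
  define U :: "bool monoid" where "U = \<lparr>carrier = UNIV, monoid.mult = (\<and>), one = True\<rparr>"
  \<comment> \<open>\<open>True\<close> is the identity; \<open>False\<close> records that \<open>c\<close> has been read, which freezes the first block
    and restarts the second.\<close>
  define l where "l e p = (if e then fst p else \<one>\<^bsub>M\<^esub>, snd p)" for e and p :: "'a \<times> 'a"
  define r where "r p e = (fst p, if e then snd p else \<one>\<^bsub>M\<^esub>)" for e and p :: "'a \<times> 'a"
  define W where "W = two_sided_semidirect (DirProd ?N ?N) U l r"
  have W_carrier: "carrier W = (N \<times> N) \<times> UNIV"
    by (simp add: W_def two_sided_semidirect_def DirProd_def U_def)
  have W_mult: "((a, b), e) \<otimes>\<^bsub>W\<^esub> ((a', b'), e') =
      ((a \<otimes>\<^bsub>M\<^esub> (if e then a' else \<one>\<^bsub>M\<^esub>), (if e' then b else \<one>\<^bsub>M\<^esub>) \<otimes>\<^bsub>M\<^esub> b'), e \<and> e')" for a b e a' b' e'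
    by (simp add: W_def two_sided_semidirect_def DirProd_def U_def l_def r_def)
  have "in_class W C"
    unfolding W_def
  proof (intro in_class_two_sided_semidirect in_class_DirProd N in_class_semilattice)
    show "fin_semilattice U"
      by (auto simp: fin_semilattice_def fin_semigroup_def U_def)
    show "commuting_actions (DirProd ?N ?N) U l r"
      by (simp add: commuting_actions_def hom_def DirProd_def U_def l_def r_def N_one N_M split_beta)
        (auto simp: N_one)
  qed
  \<comment> \<open>The state of the transducer: the block read since the last \<open>c\<close>, or \<open>None\<close> before the first \<open>c\<close>.\<close>
  define Q where "Q = insert None (Some ` N)"
  define act where "act q w = (if snd w then map_option (\<lambda>x. x \<otimes>\<^bsub>M\<^esub> snd (fst w)) q else Some (snd (fst w)))"
    for q and w :: "('a \<times> 'a) \<times> bool"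
  have act_Q: "act q w \<in> Q" if "q \<in> Q" "w \<in> carrier W" for q w
    using that by (auto simp: Q_def act_def W_carrier N_mult)
  have act_mult: "act q (w \<otimes>\<^bsub>W\<^esub> w') = act (act q w) w'"
    if "q \<in> Q" "w \<in> carrier W" "w' \<in> carrier W" for q w w'
  proof -
    obtain a b e a' b' e' where w: "w = ((a, b), e)" "w' = ((a', b'), e')"
      by (metis prod.collapse)
    then show ?thesis
      using that by (auto simp: Q_def act_def W_carrier W_mult N_M m_assoc)
  qed
  define Y where "Y = two_sided_semidirect (product_group Q (\<lambda>_. ?L)) W
      (\<lambda>w f. \<lambda>q\<in>Q. f (act q w)) (\<lambda>f w. f)"
  have Y: "in_class Y C"
    unfolding Y_def
  proof (rule in_class_wreath[OF L \<open>in_class W C\<close> _ act_Q act_mult])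
    show "finite Q"
      using finite_subset[OF N_sub fin] by (simp add: Q_def)
  qed
  have Y_carrier: "carrier Y = (\<Pi>\<^sub>E q\<in>Q. carrier ?L) \<times> carrier W"
    by (simp add: Y_def two_sided_semidirect_def)
  have Y_mult: "(f, w) \<otimes>\<^bsub>Y\<^esub> (f', w') = (\<lambda>q\<in>Q. f q \<otimes>\<^bsub>?L\<^esub> f' (act q w), w \<otimes>\<^bsub>W\<^esub> w')" for f w f' w'
    unfolding Y_def two_sided_semidirect_def by (simp cong: restrict_cong)
  \<comment> \<open>The outputs of the representatives of \<open>a x b\<close> and of the elements of \<open>N\<close>.\<close>
  define F where "F a x = (\<lambda>q\<in>Q. case q of None \<Rightarrow> x | Some b \<Rightarrow> c \<otimes>\<^bsub>M\<^esub> (b \<otimes>\<^bsub>M\<^esub> (a \<otimes>\<^bsub>M\<^esub> x)))" for a x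
  define E where "E = (\<lambda>q\<in>Q. c)"
  have F_None: "F a x None = x" for a x
    by (simp add: F_def Q_def)
  have F_Some: "F a x (Some b) = c \<otimes>\<^bsub>M\<^esub> (b \<otimes>\<^bsub>M\<^esub> (a \<otimes>\<^bsub>M\<^esub> x))" if "b \<in> N" for a x b
    using that by (simp add: F_def Q_def)
  have F_L: "F a x q \<in> carrier ?L" if a: "a \<in> N" and x: "x \<in> carrier ?L" and q: "q \<in> Q" for a x q
  proof (cases q)
    case (Some b)
    then have b: "b \<in> N"
      using q by (auto simp: Q_def)
    have "c \<otimes>\<^bsub>M\<^esub> ((b \<otimes>\<^bsub>M\<^esub> a) \<otimes>\<^bsub>M\<^esub> x) \<in> carrier ?L"
      using x by (rule L_left) (simp add: a b N_M)
    then show ?thesis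
      using a b x by (simp add: Some F_Some m_assoc N_M L_M)
  qed (simp add: F_None x)
  define R where "R y m \<longleftrightarrow> (\<exists>n\<in>N. y = (E, (n, n), True) \<and> m = n) \<or>
      (\<exists>a\<in>N. \<exists>b\<in>N. \<exists>x\<in>carrier ?L. y = (F a x, (a, b), False) \<and> m = a \<otimes>\<^bsub>M\<^esub> x \<otimes>\<^bsub>M\<^esub> b)" for y m
  have R_dest: "y \<in> carrier Y \<and> m \<in> carrier M" if "R y m" for y m
  proof -
    have "E \<in> (\<Pi>\<^sub>E q\<in>Q. carrier ?L)"
      using L.one_closed by (simp add: E_def L_one)
    moreover have "F a x \<in> (\<Pi>\<^sub>E q\<in>Q. carrier ?L)" if "a \<in> N" "x \<in> carrier ?L" for a x
      using F_L[OF that] by (auto simp: PiE_iff F_def)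
    ultimately show ?thesis
      using that by (auto simp: R_def Y_carrier W_carrier N_M L_M)
  qed
  have R_mult: "R (y \<otimes>\<^bsub>Y\<^esub> y') (m \<otimes>\<^bsub>M\<^esub> m')" if "R y m" "R y' m'" for y m y' m'
  proof -
    have EE: "R ((E, (n, n), True) \<otimes>\<^bsub>Y\<^esub> (E, (n', n'), True)) (n \<otimes>\<^bsub>M\<^esub> n')" if n: "n \<in> N" "n' \<in> N" for n n'
    proof -
      have "(\<lambda>q\<in>Q. E q \<otimes>\<^bsub>?L\<^esub> E (act q ((n, n), True))) = E"
      proof (rule extensionalityI[where A = Q])
        fix q assume q: "q \<in> Q"
        then have "act q ((n, n), True) \<in> Q"
          using n by (intro act_Q) (simp_all add: W_carrier)
        with q show "(\<lambda>q\<in>Q. E q \<otimes>\<^bsub>?L\<^esub> E (act q ((n, n), True))) q = E q"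
          using L.l_one[OF L.one_closed] by (simp add: E_def L_one)
      qed (simp_all add: E_def)
      then show ?thesis
        using n N_mult by (auto simp: R_def Y_mult W_mult)
    qed
    have EF: "R ((E, (n, n), True) \<otimes>\<^bsub>Y\<^esub> (F a x, (a, b), False)) (n \<otimes>\<^bsub>M\<^esub> (a \<otimes>\<^bsub>M\<^esub> x \<otimes>\<^bsub>M\<^esub> b))"
      if n: "n \<in> N" and ab: "a \<in> N" "b \<in> N" and x: "x \<in> carrier ?L" for n a b x
    proof -
      have "(\<lambda>q\<in>Q. E q \<otimes>\<^bsub>?L\<^esub> F a x (act q ((n, n), True))) = F (n \<otimes>\<^bsub>M\<^esub> a) x"
      proof (rule extensionalityI[where A = Q])
        fix q assume q: "q \<in> Q"
        then have q': "act q ((n, n), True) \<in> Q"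
          using n by (intro act_Q) (simp_all add: W_carrier)
        have "F a x (act q ((n, n), True)) = F (n \<otimes>\<^bsub>M\<^esub> a) x q"
        proof (cases q)
          case (Some b)
          then have "b \<in> N"
            using q by (auto simp: Q_def)
          then show ?thesis
            using n ab x by (simp add: Some act_def F_Some N_mult N_M L_M m_assoc)
        qed (simp add: act_def F_None)
        then show "(\<lambda>q\<in>Q. E q \<otimes>\<^bsub>?L\<^esub> F a x (act q ((n, n), True))) q = F (n \<otimes>\<^bsub>M\<^esub> a) x q"
          using q L.l_one[OF F_L[OF ab(1) x q']] by (simp add: E_def L_one)
      qed (simp_all add: F_def)
      moreover have "n \<otimes>\<^bsub>M\<^esub> (a \<otimes>\<^bsub>M\<^esub> x \<otimes>\<^bsub>M\<^esub> b) = (n \<otimes>\<^bsub>M\<^esub> a) \<otimes>\<^bsub>M\<^esub> x \<otimes>\<^bsub>M\<^esub> b"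
        using n ab x by (simp add: m_assoc N_M L_M)
      ultimately show ?thesis
        using n ab x N_mult by (auto simp: R_def Y_mult W_mult N_M)
    qed
    have FE: "R ((F a x, (a, b), False) \<otimes>\<^bsub>Y\<^esub> (E, (n, n), True)) (a \<otimes>\<^bsub>M\<^esub> x \<otimes>\<^bsub>M\<^esub> b \<otimes>\<^bsub>M\<^esub> n)"
      if n: "n \<in> N" and ab: "a \<in> N" "b \<in> N" and x: "x \<in> carrier ?L" for n a b x
    proof -
      have "(\<lambda>q\<in>Q. F a x q \<otimes>\<^bsub>?L\<^esub> E (act q ((a, b), False))) = F a x"
      proof (rule extensionalityI[where A = Q])
        fix q assume q: "q \<in> Q"
        then have "act q ((a, b), False) \<in> Q"
          using ab by (intro act_Q) (simp_all add: W_carrier)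
        then show "(\<lambda>q\<in>Q. F a x q \<otimes>\<^bsub>?L\<^esub> E (act q ((a, b), False))) q = F a x q"
          using q L.r_one[OF F_L[OF ab(1) x q]] by (simp add: E_def L_one)
      qed (simp_all add: F_def)
      moreover have "a \<otimes>\<^bsub>M\<^esub> x \<otimes>\<^bsub>M\<^esub> b \<otimes>\<^bsub>M\<^esub> n = a \<otimes>\<^bsub>M\<^esub> x \<otimes>\<^bsub>M\<^esub> (b \<otimes>\<^bsub>M\<^esub> n)"
        using n ab x by (simp add: m_assoc N_M L_M)
      ultimately show ?thesis
        using n ab x N_mult by (auto simp: R_def Y_mult W_mult N_M)
    qed
    have FF: "R ((F a x, (a, b), False) \<otimes>\<^bsub>Y\<^esub> (F a' x', (a', b'), False))
        (a \<otimes>\<^bsub>M\<^esub> x \<otimes>\<^bsub>M\<^esub> b \<otimes>\<^bsub>M\<^esub> (a' \<otimes>\<^bsub>M\<^esub> x' \<otimes>\<^bsub>M\<^esub> b'))"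
      if ab: "a \<in> N" "b \<in> N" "a' \<in> N" "b' \<in> N" and x: "x \<in> carrier ?L" "x' \<in> carrier ?L"
      for a b x a' b' x'
    proof -
      let ?v = "b \<otimes>\<^bsub>M\<^esub> (a' \<otimes>\<^bsub>M\<^esub> x')"
      let ?z = "x \<otimes>\<^bsub>?L\<^esub> (c \<otimes>\<^bsub>M\<^esub> ?v)"
      have v: "?v \<in> carrier M"
        using ab x by (simp add: N_M L_M)
      have z: "?z = x \<otimes>\<^bsub>M\<^esub> ?v"
        using x(1) v by (rule L_mult)
      have zL: "?z \<in> carrier ?L"
        using F_L[of a' x' "Some b"] ab x by (intro L.m_closed) (simp_all add: F_Some Q_def)
      have "(\<lambda>q\<in>Q. F a x q \<otimes>\<^bsub>?L\<^esub> F a' x' (act q ((a, b), False))) = F a ?z"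
      proof (rule extensionalityI[where A = Q])
        fix q assume q: "q \<in> Q"
        have "F a x q \<otimes>\<^bsub>?L\<^esub> (c \<otimes>\<^bsub>M\<^esub> ?v) = F a ?z q"
        proof (cases q)
          case (Some b'')
          then have b'': "b'' \<in> N"
            using q by (auto simp: Q_def)
          have "F a x q \<otimes>\<^bsub>?L\<^esub> (c \<otimes>\<^bsub>M\<^esub> ?v) = F a x q \<otimes>\<^bsub>M\<^esub> ?v"
            using F_L[OF ab(1) x(1) q] v by (rule L_mult)
          then show ?thesis
            unfolding z using ab b'' x v c by (simp add: Some F_Some m_assoc N_M L_M)
        qed (simp add: F_None)
        then show "(\<lambda>q\<in>Q. F a x q \<otimes>\<^bsub>?L\<^esub> F a' x' (act q ((a, b), False))) q = F a ?z q"
          using q ab by (simp add: act_def F_Some)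
      qed (simp_all add: F_def)
      moreover have "a \<otimes>\<^bsub>M\<^esub> x \<otimes>\<^bsub>M\<^esub> b \<otimes>\<^bsub>M\<^esub> (a' \<otimes>\<^bsub>M\<^esub> x' \<otimes>\<^bsub>M\<^esub> b') = a \<otimes>\<^bsub>M\<^esub> ?z \<otimes>\<^bsub>M\<^esub> b'"
        unfolding z using ab x by (simp add: m_assoc N_M L_M)
      ultimately show ?thesis
        using ab zL by (auto simp: R_def Y_mult W_mult N_M)
    qed
    show ?thesis
      using that EE EF FE FF unfolding R_def[of y m] R_def[of y' m'] by (elim disjE bexE conjE) simp_all
  qed
  \<comment> \<open>No words over \<open>N\<close> and \<open>c\<close> are needed: the represented elements form a submonoid that contains
    \<open>N\<close> and \<open>c\<close>.\<close>
  have onto: "{m. \<exists>y. R y m} = carrier M"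
  proof (rule gen)
    have R_N: "R (E, (n, n), True) n" if "n \<in> N" for n
      using that by (auto simp: R_def)
    show "N \<subseteq> {m. \<exists>y. R y m}"
      using R_N by blast
    show "submonoid {m. \<exists>y. R y m} M"
    proof
      show "{m. \<exists>y. R y m} \<subseteq> carrier M"
        using R_dest by blast
      show "\<one>\<^bsub>M\<^esub> \<in> {m. \<exists>y. R y m}"
        using R_N N_one by blast
      show "m \<otimes>\<^bsub>M\<^esub> m' \<in> {m. \<exists>y. R y m}" if "m \<in> {m. \<exists>y. R y m}" "m' \<in> {m. \<exists>y. R y m}" for m m'
        using that R_mult by blast
    qed
    have "R (F \<one>\<^bsub>M\<^esub> c, (\<one>\<^bsub>M\<^esub>, \<one>\<^bsub>M\<^esub>), False) (\<one>\<^bsub>M\<^esub> \<otimes>\<^bsub>M\<^esub> c \<otimes>\<^bsub>M\<^esub> \<one>\<^bsub>M\<^esub>)"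
      using N_one L.one_closed by (auto simp: R_def L_one)
    then show "c \<in> {m. \<exists>y. R y m}"
      using c by auto
  qed
  \<comment> \<open>The blocks \<open>a\<close> and \<open>b\<close> are visible in a representative, and \<open>x\<close> is its output at \<open>None\<close>.\<close>
  have "sgrp_divides M Y"
  proof (rule sgrp_divides_by_relation[where R = R])
    show "carrier M \<noteq> {}"
      using one_closed by blast
    show "\<exists>y. R y m" if "m \<in> carrier M" for m
      using that onto by blast
    show "m = m'" if "R y m" "R y m'" for y m m'
    proof -
      have "x = x'" if "F a x = F a x'" for a x x'
        using F_None that by metis
      then show ?thesis
        using that unfolding R_def by auto
    qed
  qed (fact R_dest R_mult)+
  with Y show ?thesis
    by (rule in_class_divides)
qed

end

section \<open>Induction on the order of a monoid\<close>

lemma (in group) fin_semilattice_trivial_group: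
  assumes "carrier G = {\<one>}"
  shows "fin_semilattice G"
  using assms by (simp add: fin_semilattice_def fin_semigroup_def)

text \<open>
  Requiring the units to lie in \<open>N\<close> forces \<open>c\<close> to be a non-unit, which makes its local divisor smaller
  than the monoid. Maximality of \<open>N\<close> takes the place of a generating set.
\<close>
lemma (in monoid) maximal_submonoid_over_Units:
  assumes "finite (carrier G)" "Units G \<noteq> carrier G"
  obtains N c where "submonoid N G" "Units G \<subseteq> N" "c \<in> carrier G" "c \<notin> N"
    "\<And>K. submonoid K G \<Longrightarrow> N \<subseteq> K \<Longrightarrow> c \<in> K \<Longrightarrow> K = carrier G"
proof -
  let ?A = "{K. submonoid K G \<and> Units G \<subseteq> K \<and> K \<noteq> carrier G}"
  have sub: "K \<subseteq> carrier G" if "submonoid K G" for K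
    using that by (rule submonoid.subset)
  have "?A \<subseteq> Pow (carrier G)"
    using sub by blast
  then have "finite ?A"
    by (rule finite_subset) (simp add: assms(1))
  moreover have "submonoid (Units G) G"
    by unfold_locales auto
  then have "Units G \<in> ?A"
    using assms(2) by simp
  then have "?A \<noteq> {}"
    by blast
  ultimately have "\<exists>N\<in>?A. \<forall>K\<in>?A. N \<subseteq> K \<longrightarrow> N = K"
    by (rule finite_has_maximal)
  then obtain N where N: "N \<in> ?A" "\<And>K. K \<in> ?A \<Longrightarrow> N \<subseteq> K \<Longrightarrow> N = K"
    by (elim bexE) simp
  then obtain c where c: "c \<in> carrier G" "c \<notin> N"
    using sub by blast
  show thesis
  proof
    show "submonoid N G" "Units G \<subseteq> N" "c \<in> carrier G" "c \<notin> N"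
      using N(1) c by simp_all
    show "K = carrier G" if "submonoid K G" "N \<subseteq> K" "c \<in> K" for K
    proof (rule ccontr)
      assume "K \<noteq> carrier G"
      then have "K \<in> ?A"
        using that N(1) by auto
      then have "N = K"
        using that(2) by (rule N(2))
      then show False
        using that(3) c(2) by simp
    qed
  qed
qed

context semidirect_variety
begin

text \<open>
  The hypothesis on simple groups is inherited by divisors, and the factors of both decompositions
  are strictly smaller divisors of \<open>M\<close>.
\<close>
theorem in_class_monoid:
  fixes M :: "'a monoid"
  assumes "monoid M" "finite (carrier M)"
    and "\<And>G :: nat monoid. simple_group G \<Longrightarrow> sgrp_divides G M \<Longrightarrow> G \<in> C"
  shows "in_class M C"
  using assms
proof (induction "card (carrier M)" arbitrary: M rule: less_induct)
  case less
  interpret monoid M by fact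
  note fin = \<open>finite (carrier M)\<close>
  have IH: "in_class T C"
    if "monoid T" "sgrp_divides T M" "card (carrier T) < card (carrier M)" for T :: "'a monoid"
  proof (rule less.hyps[OF that(3,1)])
    have "fin_semigroup T"
      using that(2) fin_semigroup_monoid[OF fin] by (rule fin_semigroup_divides)
    then show "finite (carrier T)"
      by (simp add: fin_semigroup_def)
    show "G \<in> C" if G: "simple_group G" "sgrp_divides G T" for G :: "nat monoid"
      using less.prems(3)[OF G(1) sgrp_divides_trans[OF G(2) \<open>sgrp_divides T M\<close>]] .
  qed
  show ?case
  proof (cases "Units M = carrier M")
    case True
    then interpret group M
      by unfold_locales auto
    consider "carrier M = {\<one>\<^bsub>M\<^esub>}" | "simple_group M"
      | H where "H \<lhd> M" "H \<noteq> carrier M" "H \<noteq> {\<one>\<^bsub>M\<^esub>}"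
    proof (cases "carrier M = {\<one>\<^bsub>M\<^esub>}")
      case False
      then have "order M \<noteq> 1"
        using one_closed by (metis card_1_singletonE order_def singletonD)
      moreover have "order M > 0"
        using fin by (simp add: order_gt_0_iff_finite)
      ultimately have "order M > 1"
        by simp
      show ?thesis
      proof (cases "\<forall>H. H \<lhd> M \<longrightarrow> H = carrier M \<or> H = {\<one>\<^bsub>M\<^esub>}")
        case True
        with \<open>order M > 1\<close> have "simple_group M"
          by unfold_locales simp_all
        then show ?thesis
          by (rule that(2))
      next
        case False
        then show ?thesis
          using that(3) by blast
      qed
    qed (rule that(1))
    then show ?thesis
    proof cases
      case 1
      then show ?thesis
        by (intro in_class_semilattice fin_semilattice_trivial_group)
    next
      case 2
      then show ?thesis
        using less.prems(3) by (rule in_class_simple_group)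
    next
      case 3
      interpret normal H M by fact
      have H: "H \<subset> carrier M" "H \<noteq> {}"
        using subset \<open>H \<noteq> carrier M\<close> subgroup.one_closed[OF subgroup_axioms] by blast+
      show ?thesis
      proof (rule in_class_extension[OF \<open>H \<lhd> M\<close> fin])
        show "in_class (M\<lparr>carrier := H\<rparr>) C"
        proof (rule IH)
          show "monoid (M\<lparr>carrier := H\<rparr>)"
            using subgroup_is_group[OF is_group] by (rule group.is_monoid)
          show "sgrp_divides (M\<lparr>carrier := H\<rparr>) M"
            using H subgroup.m_closed[OF subgroup_axioms]
            by (intro sgrp_divides_subsemigroup) (auto simp: subsemigroup_def)
          show "card (carrier (M\<lparr>carrier := H\<rparr>)) < card (carrier M)"
            using psubset_card_mono[OF fin H(1)] by simp
        qed
        show "in_class (transversal_quotient M H) C"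
        proof (rule IH)
          show "sgrp_divides (transversal_quotient M H) M"
            by (rule sgrp_divides_epi[OF coset_rep_epi fin_semigroup_monoid[OF fin]])
        qed (fact monoid_transversal_quotient card_transversal_quotient_less[OF fin \<open>H \<noteq> {\<one>\<^bsub>M\<^esub>}\<close>])+
      qed
    qed
  next
    case False
    with fin obtain N c where N: "submonoid N M" "Units M \<subseteq> N" and c: "c \<in> carrier M" "c \<notin> N"
      and gen: "\<And>K. submonoid K M \<Longrightarrow> N \<subseteq> K \<Longrightarrow> c \<in> K \<Longrightarrow> K = carrier M"
      using maximal_submonoid_over_Units by metis
    have N_sub: "N \<subset> carrier M" "N \<noteq> {}"
      using submonoid.subset[OF N(1)] submonoid.one_closed[OF N(1)] c by blast+
    show ?thesis
    proof (rule in_class_local_divisor_extension[OF monoid_axioms fin N(1) c(1) gen])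
      show "in_class (M\<lparr>carrier := N\<rparr>) C"
      proof (rule IH)
        show "monoid (M\<lparr>carrier := N\<rparr>)"
          using submonoid.submonoid_is_monoid[OF N(1) monoid_axioms] .
        show "sgrp_divides (M\<lparr>carrier := N\<rparr>) M"
          using N_sub submonoid.m_closed[OF N(1)]
          by (intro sgrp_divides_subsemigroup) (auto simp: subsemigroup_def)
        show "card (carrier (M\<lparr>carrier := N\<rparr>)) < card (carrier M)"
          using psubset_card_mono[OF fin N_sub(1)] by simp
      qed
      show "in_class (local_divisor M c) C"
      proof (rule IH)
        show "card (carrier (local_divisor M c)) < card (carrier M)"
          using c N(2) fin by (intro card_local_divisor_less) auto
      qed (use c in \<open>simp_all add: monoid_local_divisor local_divisor_divides\<close>)
    qed
  qed
qed

end

definition adjoin_one :: "('a, 'b) monoid_scheme \<Rightarrow> 'a option monoid" where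
  "adjoin_one S =
     \<lparr>carrier = insert None (Some ` carrier S),
      monoid.mult = (\<lambda>x y. case x of None \<Rightarrow> y | Some a \<Rightarrow>
        (case y of None \<Rightarrow> x | Some b \<Rightarrow> Some (a \<otimes>\<^bsub>S\<^esub> b))),
      one = None\<rparr>"

lemma monoid_adjoin_one:
  assumes "fin_semigroup S"
  shows "monoid (adjoin_one S)"
  using assms by unfold_locales (auto simp: adjoin_one_def fin_semigroup_def)

lemma sgrp_divides_adjoin_one:
  assumes "fin_semigroup S"
  shows "sgrp_divides S (adjoin_one S)"
proof (rule sgrp_divides_inj_hom[OF _ _ assms])
  show "Some \<in> hom S (adjoin_one S)"
    by (intro homI) (auto simp: adjoin_one_def)
qed simp

text \<open>
  The new identity can only be mapped to \<open>\<one>\<close>, and it can be spared there: a simple group has an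
  element \<open>h \<noteq> \<one>\<close>, and \<open>h\<close> and its inverse come from elements of \<open>S\<close>, hence so does their product \<open>\<one>\<close>.
\<close>
lemma simple_group_divides_adjoin_one:
  assumes "simple_group G" "sgrp_divides G (adjoin_one S)"
  shows "sgrp_divides G S"
proof -
  interpret simple_group G by fact
  obtain H f where "subsemigroup H (adjoin_one S)" and f: "f \<in> epi (adjoin_one S\<lparr>carrier := H\<rparr>) G"
    using assms(2) unfolding sgrp_divides_def by blast
  then have H: "H \<subseteq> insert None (Some ` carrier S)"
    "\<And>x y. x \<in> H \<Longrightarrow> y \<in> H \<Longrightarrow> x \<otimes>\<^bsub>adjoin_one S\<^esub> y \<in> H"
    by (auto simp: subsemigroup_def adjoin_one_def)
  have fm: "f (x \<otimes>\<^bsub>adjoin_one S\<^esub> y) = f x \<otimes>\<^bsub>G\<^esub> f y" if "x \<in> H" "y \<in> H" for x y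
    using f that by (auto simp: epi_def hom_def)
  have fH: "f ` H = carrier G"
    using f by (simp add: epi_def)
  have fc: "f x \<in> carrier G" if "x \<in> H" for x
    using that by (simp flip: fH)
  have Some_mult: "Some a \<otimes>\<^bsub>adjoin_one S\<^esub> Some b = Some (a \<otimes>\<^bsub>S\<^esub> b)" for a b
    by (simp add: adjoin_one_def)
  have Some_H: "Some (a \<otimes>\<^bsub>S\<^esub> b) \<in> H" "f (Some (a \<otimes>\<^bsub>S\<^esub> b)) = f (Some a) \<otimes>\<^bsub>G\<^esub> f (Some b)"
    if "Some a \<in> H" "Some b \<in> H" for a b
    using H(2)[OF that] fm[OF that] by (simp_all add: Some_mult)
  have None: "f None = \<one>\<^bsub>G\<^esub>" if "None \<in> H"
  proof -
    have "f None \<otimes>\<^bsub>G\<^esub> f None = f None"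
      using fm[OF that that] by (simp add: adjoin_one_def)
    then show ?thesis
      using fc[OF that] by simp
  qed
  have nontrivial: "\<exists>a. Some a \<in> H \<and> f (Some a) = g" if "g \<in> carrier G" "g \<noteq> \<one>\<^bsub>G\<^esub>" for g
  proof -
    have "g \<in> f ` H"
      using that(1) by (simp add: fH)
    then obtain x where "x \<in> H" "g = f x"
      by blast
    then show ?thesis
      using None that(2) by (cases x) auto
  qed
  show ?thesis
  proof (rule sgrp_divides_by_relation[where R = "\<lambda>a g. Some a \<in> H \<and> f (Some a) = g"])
    show "carrier G \<noteq> {}"
      using one_closed by blast
    show "\<exists>a. Some a \<in> H \<and> f (Some a) = g" if "g \<in> carrier G" for g
    proof (cases "g = \<one>\<^bsub>G\<^esub>")
      case True
      obtain h where h: "h \<in> carrier G" "h \<noteq> \<one>\<^bsub>G\<^esub>"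
        using simple_not_triv one_closed by blast
      then have "inv\<^bsub>G\<^esub> h \<noteq> \<one>\<^bsub>G\<^esub>"
        by (simp add: inv_eq_1_iff)
      then obtain b where b: "Some b \<in> H" "f (Some b) = inv\<^bsub>G\<^esub> h"
        using nontrivial h(1) by blast
      obtain a where a: "Some a \<in> H" "f (Some a) = h"
        using nontrivial h by blast
      have "f (Some (a \<otimes>\<^bsub>S\<^esub> b)) = g"
        using Some_H(2)[OF a(1) b(1)] a(2) b(2) h(1) True by simp
      then show ?thesis
        using Some_H(1)[OF a(1) b(1)] by blast
    qed (use nontrivial that in blast)
    show "a \<in> carrier S \<and> g \<in> carrier G" if "Some a \<in> H \<and> f (Some a) = g" for a g
      using that H(1) fc by blast
  qed (use Some_H in auto)
qed

theorem theorem3p1: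
  fixes S :: "('a, 'b) monoid_scheme"
  assumes "fin_semigroup S"
  shows "in_class S (V_class S)"
proof -
  interpret semidirect_variety "V_class S"
    using admissible_V_class[of S] by unfold_locales (simp_all add: admissible_def)
  have "in_class (adjoin_one S) (V_class S)"
  proof (rule in_class_monoid)
    show "monoid (adjoin_one S)"
      using assms by (rule monoid_adjoin_one)
    show "finite (carrier (adjoin_one S))"
      using assms by (simp add: adjoin_one_def fin_semigroup_def)
    have "\<forall>G :: nat monoid. simple_group G \<and> sgrp_divides G S \<longrightarrow> G \<in> V_class S"
      using admissible_V_class[of S] unfolding admissible_def by (elim conjE)
    then show "G \<in> V_class S" if "simple_group G" "sgrp_divides G (adjoin_one S)" for G :: "nat monoid"
      using that(1) simple_group_divides_adjoin_one[OF that] by blast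
  qed
  then show ?thesis
    using sgrp_divides_adjoin_one[OF assms] by (rule in_class_divides)
qed

end
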